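(* Suppose $X$ is a nonnegative random variable with $\mathrm{Var}(X)>0$. (a) $\mathscr{L}(X)$ is infinitely divisible if and only if there exists a random variable $X'\ge0$ a.s., independent of $X$, such that $$X^s\stackrel{d}{=}X+X',$$ where $X^s$ has the $X$-size biased distribution. (b) $\mathscr{L}(X)$ is infinitely divisible if and only if there exists a random variable $X''$ independent of $X$ such that $$X^z\stackrel{d}{=}X+X'',$$ where $X^z$ has the $X$-zero biased distribution. The distribution of $X''$ has the density function $$\frac{1}{\mathbb{E}X'}\,\mathbb{P}(X'\ge x),\qquad x\ge0,$$ where $X'$ is uniquely determined (in distribution) by the relation $X^s\stackrel{d}{=}X+X'$ in (a).
   Context: $\mathscr{L}(X)$ is the law of $X$ and $\stackrel{d}{=}$ denotes equality in distribution. The biased distributions are as defined below, so $X$ is understood to have finite mean where $X^s$ is used and finite variance where $X^z$ is used. Size bias: for a nonnegative random variable $V$ with finite mean $\mu$, $V^s$ has the $V$-size biased distribution if $\mathbb{E}[Vf(V)]=\mu\,\mathbb{E}f(V^s)$ for all functions $f$ with $\mathbb{E}|Vf(V)|<\infty$. Zero bias: for a random variable $V$ with mean $\mu$ and variance $\sigma^2\in(0,\infty)$, $V^z$ has the $V$-zero biased distribution if $\mathbb{E}[(V-\mu)f(V)]=\sigma^2\,\mathbb{E}f'(V^z)$ for all differentiable functions $f$ with $\mathbb{E}|Vf(V)|<\infty$.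
   Formalization: In (b), "if" is false for arbitrary X'' (e.g. X on {0,1,...} with generating function exp(z-εz²+z³+z⁴-3+ε), small ε>0); there X'' is required to have density P(X'≥x)/EX' for some integrable X'≥0. When X is infinitely divisible every X'' has this density, with X' as in (a). *)

theory Defs
  imports "HOL-Probability.Probability"
begin

text \<open>Under the product measure the coordinates are $n$ independent copies of a random variable
  with law \<open>\<nu>\<close>.\<close>

definition infinitely_divisible :: "real measure \<Rightarrow> bool" where
  "infinitely_divisible \<mu> \<longleftrightarrow>
     (\<forall>n::nat. n \<ge> 1 \<longrightarrow>
       (\<exists>\<nu>::real measure. prob_space \<nu> \<and> sets \<nu> = sets borel \<and>
          distr (\<Pi>\<^sub>M i\<in>{..<n}. \<nu>) borel (\<lambda>x. \<Sum>i<n. x i) = \<mu>))"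

text \<open>\<open>size_biased M V N W\<close>: the random variable \<open>W\<close> on \<open>N\<close> has the size biased distribution of
  the random variable \<open>V\<close> on \<open>M\<close>.\<close>

definition size_biased ::
  "'a measure \<Rightarrow> ('a \<Rightarrow> real) \<Rightarrow> 'b measure \<Rightarrow> ('b \<Rightarrow> real) \<Rightarrow> bool" where
  "size_biased M V N W \<longleftrightarrow>
     prob_space N \<and> W \<in> borel_measurable N \<and>
     (\<forall>f::real \<Rightarrow> real. f \<in> borel_measurable borel \<longrightarrow>
        integrable M (\<lambda>\<omega>. V \<omega> * f (V \<omega>)) \<longrightarrow>
        (\<integral>\<omega>. V \<omega> * f (V \<omega>) \<partial>M) = (\<integral>\<omega>. V \<omega> \<partial>M) * (\<integral>\<omega>. f (W \<omega>) \<partial>N))"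

text \<open>The integrability of \<open>f' (W)\<close> has to be assumed: it does not follow from that of \<open>V * f (V)\<close>
  (for instance \<open>f\<close> may vanish on the support of \<open>V\<close> and oscillate wildly in its gaps, which the
  zero biased distribution charges), and the Bochner integral would then silently be 0.\<close>

definition zero_biased ::
  "'a measure \<Rightarrow> ('a \<Rightarrow> real) \<Rightarrow> 'b measure \<Rightarrow> ('b \<Rightarrow> real) \<Rightarrow> bool" where
  "zero_biased M V N W \<longleftrightarrow>
     prob_space N \<and> W \<in> borel_measurable N \<and>
     (\<forall>f f' :: real \<Rightarrow> real. (\<forall>x. (f has_real_derivative f' x) (at x)) \<longrightarrow>
        integrable M (\<lambda>\<omega>. V \<omega> * f (V \<omega>)) \<longrightarrow> integrable N (\<lambda>\<omega>. f' (W \<omega>)) \<longrightarrow>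
        (\<integral>\<omega>. (V \<omega> - (\<integral>\<omega>. V \<omega> \<partial>M)) * f (V \<omega>) \<partial>M) =
          prob_space.variance M V * (\<integral>\<omega>. f' (W \<omega>) \<partial>N))"

text \<open>\<open>indep_decomp M X N W P Y Z\<close>: \<open>W\<close> equals in distribution \<open>X + Z\<close> with \<open>Z\<close> independent of \<open>X\<close>.
  As the space \<open>M\<close> of \<open>X\<close> need not carry a suitable \<open>Z\<close>, the pair is realised on a probability
  space \<open>P\<close>, where \<open>Y\<close> is the copy of \<open>X\<close>. When such \<open>P\<close>, \<open>Y\<close>, \<open>Z\<close> are asserted to exist it
  suffices to let \<open>P\<close> be a measure on pairs of reals, namely the joint law of the two variables.\<close>

definition indep_decomp ::
  "'a measure \<Rightarrow> ('a \<Rightarrow> real) \<Rightarrow> 'b measure \<Rightarrow> ('b \<Rightarrow> real) \<Rightarrow>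
   'c measure \<Rightarrow> ('c \<Rightarrow> real) \<Rightarrow> ('c \<Rightarrow> real) \<Rightarrow> bool" where
  "indep_decomp M X N W P Y Z \<longleftrightarrow>
     prob_space P \<and> prob_space.indep_var P borel Y borel Z \<and>
     distr P borel Y = distr M borel X \<and>
     distr N borel W = distr P borel (\<lambda>\<omega>. Y \<omega> + Z \<omega>)"

text \<open>\<open>tail_density P X'' Q X'\<close>: \<open>X'\<close> is a nonnegative random variable on \<open>Q\<close> with finite mean, and
  \<open>X''\<close> on \<open>P\<close> has the density $\mathbb{P}(X' \ge x) / \mathbb{E} X'$ on $x \ge 0$. That
  $\mathbb{E} X' > 0$ is implied, since otherwise the function displayed is 0 and not a
  probability density.

  This form of the density cannot be dropped when one infers that \<open>X\<close> is infinitely divisible from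
  $X^z = X + X''$ in distribution: with $\varepsilon > 0$ small, the law on the natural numbers with
  generating function $\exp (z - \varepsilon z^2 + z^3 + z^4 - (3 - \varepsilon))$ is not infinitely
  divisible, although such an $X''$ exists (with a density on $[0, 4)$ that is not monotone).\<close>

definition tail_density ::
  "'a measure \<Rightarrow> ('a \<Rightarrow> real) \<Rightarrow> 'b measure \<Rightarrow> ('b \<Rightarrow> real) \<Rightarrow> bool" where
  "tail_density P X'' Q X' \<longleftrightarrow>
     prob_space P \<and> prob_space Q \<and> X' \<in> borel_measurable Q \<and>
     (AE \<omega> in Q. 0 \<le> X' \<omega>) \<and> integrable Q X' \<and>
     distributed P lborel X''
       (\<lambda>x. ennreal (if 0 \<le> x then measure Q {\<omega> \<in> space Q. x \<le> X' \<omega>} / (\<integral>\<omega>. X' \<omega> \<partial>Q) else 0))"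

end

theory Submission
  imports Defs
begin

text \<open>Let \<open>\<phi>\<close>, \<open>\<psi>\<close> be the characteristic functions of \<open>X\<close> and \<open>X'\<close>. That of \<open>X\<^sup>s\<close> is \<open>\<phi>' / (i \<mu>)\<close>,
  hence $X^s = X + X'$ in distribution is the differential equation \<open>\<phi>' = i \<mu> \<phi> \<psi>\<close>, whose solution
  is the exponential of \<open>\<mu>\<close> times the integral of $(e^{itx} - 1) / x$ against the law of \<open>X'\<close>, with
  value \<open>it\<close> at \<open>x = 0\<close>. For \<open>X' \<ge> 0\<close> such an exponential is a limit of compound sums and its
  convolution roots have the same form. Conversely, if \<open>X\<close> is the sum of \<open>n\<close> independent copies of
  \<open>X\<^sub>n\<close>, then $X^s$ is $X_n^s$ plus \<open>n - 1\<close> independent copies of \<open>X\<^sub>n\<close>; the tails of $X_n^s$ are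
  dominated by those of $X^s$, so \<open>X'\<close> arises as a subsequential weak limit of $X_n^s$.

  The zero biased law has characteristic function $\mu (\phi_s - \phi) / (\sigma^2 i t)$ and the density
  \<open>P (X' \<ge> x) / a\<close> with \<open>a = E X'\<close> has characteristic function \<open>(\<psi> - 1) / (a i t)\<close>. So (b) amounts to
  $\phi_s = \phi (1 + c (\psi - 1))$ with $c = \sigma^2 / (\mu a)$, where \<open>\<phi>\<close> is an exponential as
  before times that of a deterministic shift \<open>\<mu> (1 - c)\<close>, possibly negative.\<close>

subsection \<open>Differentiation under the integral and the Levy kernel\<close>

lemma norm_iexp_diff_le: "norm (iexp a - iexp b) \<le> \<bar>a - b\<bar>"
proof -
  have "iexp a - iexp b = iexp b * (iexp (a - b) - 1)"
    by (simp add: algebra_simps flip: exp_add)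
  moreover have "norm (iexp (a - b) - 1) \<le> \<bar>a - b\<bar>"
    using iexp_approx1[of "a - b" 0] by simp
  ultimately show ?thesis
    by (simp add: norm_mult)
qed

text \<open>Quotient limits along \<open>at t\<close> can be tested on sequences, which is the form
  that dominated convergence accepts.\<close>

lemma has_vector_derivative_iff_quotient:
  fixes f :: "real \<Rightarrow> 'b::real_normed_vector"
  shows "(f has_vector_derivative D) (at t) \<longleftrightarrow> ((\<lambda>s. (f s - f t) /\<^sub>R (s - t)) \<longlongrightarrow> D) (at t)"
proof -
  have "norm (f s - f t - (s - t) *\<^sub>R D) / norm (s - t) = norm ((f s - f t) /\<^sub>R (s - t) - D)"
    if "s \<noteq> t" for s
  proof -
    have "(f s - f t) /\<^sub>R (s - t) - D = (f s - f t - (s - t) *\<^sub>R D) /\<^sub>R (s - t)"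
      using that by (simp add: scaleR_diff_right)
    then show ?thesis
      by (simp add: divide_inverse mult.commute)
  qed
  then have "((\<lambda>s. norm (f s - f t - (s - t) *\<^sub>R D) / norm (s - t)) \<longlongrightarrow> 0) (at t) \<longleftrightarrow>
      ((\<lambda>s. norm ((f s - f t) /\<^sub>R (s - t) - D)) \<longlongrightarrow> 0) (at t)"
    by (intro Lim_cong_within) auto
  also have "\<dots> \<longleftrightarrow> ((\<lambda>s. (f s - f t) /\<^sub>R (s - t)) \<longlongrightarrow> D) (at t)"
    by (simp add: tendsto_norm_zero_iff flip: Lim_null)
  finally show ?thesis
    unfolding has_vector_derivative_def has_derivative_iff_norm
    by (simp add: bounded_linear_scaleR_left)
qed

text \<open>The bound on the increments from \<open>t\<close> makes \<open>B\<close> dominate every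
  difference quotient at \<open>t\<close>, so dominated convergence applies along each sequence
  tending to \<open>t\<close>.\<close>

lemma has_vector_derivative_integral_lipschitz:
  fixes h :: "real \<Rightarrow> 'a \<Rightarrow> 'b::{banach, second_countable_topology}"
  assumes int: "\<And>s. integrable M (h s)"
    and lip: "\<And>s x. norm (h s x - h t x) \<le> \<bar>s - t\<bar> * B x"
    and B: "integrable M B"
    and deriv: "\<And>x. ((\<lambda>s. h s x) has_vector_derivative h' x) (at t)"
    and h': "h' \<in> borel_measurable M"
  shows "((\<lambda>s. \<integral>x. h s x \<partial>M) has_vector_derivative (\<integral>x. h' x \<partial>M)) (at t)"
proof -
  have lim: "((\<lambda>s. (h s x - h t x) /\<^sub>R (s - t)) \<longlongrightarrow> h' x) (at t)" for x
    using deriv[of x] by (simp add: has_vector_derivative_iff_quotient)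
  have [measurable]: "h s \<in> borel_measurable M" for s
    using int by auto
  have eq: "((\<integral>x. h s x \<partial>M) - (\<integral>x. h t x \<partial>M)) /\<^sub>R (s - t) = (\<integral>x. (h s x - h t x) /\<^sub>R (s - t) \<partial>M)" for s
    using int by simp
  show ?thesis
    unfolding has_vector_derivative_iff_quotient eq
    unfolding tendsto_at_iff_sequentially o_def
  proof safe
    fix X :: "nat \<Rightarrow> real"
    assume X: "\<forall>i. X i \<in> UNIV - {t}" "X \<longlonglongrightarrow> t"
    show "(\<lambda>i. \<integral>x. (h (X i) x - h t x) /\<^sub>R (X i - t) \<partial>M) \<longlonglongrightarrow> (\<integral>x. h' x \<partial>M)"
    proof (rule integral_dominated_convergence[where w = B])
      show "AE x in M. (\<lambda>i. (h (X i) x - h t x) /\<^sub>R (X i - t)) \<longlonglongrightarrow> h' x"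
        using X lim by (auto simp: tendsto_at_iff_sequentially o_def)
      show "AE x in M. norm ((h (X i) x - h t x) /\<^sub>R (X i - t)) \<le> B x" for i
      proof (rule AE_I2)
        fix x
        have "norm ((h (X i) x - h t x) /\<^sub>R (X i - t)) = norm (h (X i) x - h t x) / \<bar>X i - t\<bar>"
          by (simp add: divide_inverse_commute)
        also have "\<dots> \<le> B x"
          using X(1) lip[of "X i" x] by (simp add: pos_divide_le_eq mult.commute)
        finally show "norm ((h (X i) x - h t x) /\<^sub>R (X i - t)) \<le> B x" .
      qed
    qed (use h' B in auto)
  qed
qed

text \<open>The power is the exponential of \<open>Suc n * Ln (1 + z n / Suc n)\<close>, and
  \<open>Ln (1 + v) / v\<close> tends to 1 as \<open>v\<close> tends to 0. This is the limit theorem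
  behind the approximation by sums of many small jumps.\<close>

lemma tendsto_one_plus_div_power_exp:
  fixes z :: "nat \<Rightarrow> complex"
  assumes z: "z \<longlonglongrightarrow> w"
  shows "(\<lambda>n. (1 + z n / of_nat (Suc n)) ^ Suc n) \<longlonglongrightarrow> exp w"
proof -
  \<comment> \<open>The value 1 at 0 makes \<open>f\<close> continuous there, so indices with
    \<open>z n = 0\<close> need no separate treatment.\<close>
  define f :: "complex \<Rightarrow> complex" where "f = (\<lambda>v. if v = 0 then 1 else Ln (1 + v) / v)"
  have f: "(f \<longlongrightarrow> 1) (nhds 0)"
  proof -
    have "((\<lambda>v. Ln (1 + v)) has_field_derivative 1) (at 0)"
      by (auto intro!: derivative_eq_intros)
    then have "((\<lambda>v. Ln (1 + v) / v) \<longlongrightarrow> 1) (at 0)"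
      by (simp add: has_field_derivative_iff)
    then have "(f \<longlongrightarrow> 1) (at 0)"
      by (rule Lim_transform_eventually) (auto simp: f_def eventually_at_filter)
    then show ?thesis
      by (simp add: f_def tendsto_nhds_iff)
  qed
  define v where "v n = z n / of_nat (Suc n)" for n
  have v: "v \<longlonglongrightarrow> 0"
  proof -
    have "(\<lambda>n. of_real (1 / real (Suc n)) :: complex) \<longlonglongrightarrow> of_real 0"
      by (intro tendsto_of_real LIMSEQ_Suc[OF lim_1_over_n])
    from tendsto_mult[OF z this] show ?thesis by (simp add: v_def[abs_def])
  qed
  have "(\<lambda>n. exp (z n * f (v n))) \<longlonglongrightarrow> exp (w * 1)"
    by (intro tendsto_intros z filterlim_compose[OF f v])
  moreover have "\<forall>\<^sub>F n in sequentially. exp (z n * f (v n)) = (1 + z n / of_nat (Suc n)) ^ Suc n"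
  proof -
    \<comment> \<open>Inside the unit ball \<open>1 + v n\<close> is nonzero, so \<open>exp\<close>
      undoes \<open>Ln\<close>.\<close>
    have "\<forall>\<^sub>F n in sequentially. v n \<in> ball 0 1"
      using v by (rule topological_tendstoD) auto
    then show ?thesis
    proof eventually_elim
      case (elim n)
      have nz: "1 + v n \<noteq> 0"
        using elim by (metis add_eq_0_iff dist_0_norm less_irrefl mem_ball norm_minus_cancel norm_one)
      have "z n * f (v n) = of_nat (Suc n) * Ln (1 + v n)"
        by (auto simp: f_def v_def field_simps simp del: of_nat_Suc)
      then have "exp (z n * f (v n)) = exp (Ln (1 + v n)) ^ Suc n"
        by (simp add: exp_of_nat_mult[symmetric] del: of_nat_Suc power_Suc)
      then show ?case using nz by (simp add: v_def)
    qed
  qed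
  ultimately show ?thesis
    by (auto intro: Lim_transform_eventually)
qed

text \<open>Integrating factor: \<open>F t * exp (- H t)\<close> has derivative 0, hence is
  constant, with value 1 at \<open>t = 0\<close>.\<close>

lemma exp_unique_ode:
  fixes F H h :: "real \<Rightarrow> complex"
  assumes F: "\<And>t. (F has_vector_derivative F t * h t) (at t)"
    and H: "\<And>t. (H has_vector_derivative h t) (at t)"
    and "F 0 = 1" "H 0 = 0"
  shows "F t = exp (H t)"
proof -
  have "((\<lambda>t. F t * exp (- H t)) has_vector_derivative 0) (at t)" for t
  proof -
    have "((\<lambda>t. exp (- H t)) has_vector_derivative (- h t) * exp (- H t)) (at t)"
      using field_vector_diff_chain_at[of "\<lambda>t. - H t" "- h t" t exp "exp (- H t)"] H[of t]
      by (auto simp: o_def intro!: derivative_eq_intros)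
    from has_vector_derivative_mult[OF F this] show ?thesis
      by (simp add: algebra_simps)
  qed
  then obtain c where c: "\<And>t. F t * exp (- H t) = c"
    using has_vector_derivative_zero_constant[of UNIV "\<lambda>t. F t * exp (- H t)"] by auto
  from c[of 0] assms have "c = 1" by simp
  with c[of t] show ?thesis by (simp add: exp_minus field_simps)
qed

text \<open>Integrand of the Levy-Khintchine exponent for a Levy measure of the form
  \<open>\<nu>(dx) / x\<close> without compensation. The value at \<open>x = 0\<close> is the
  continuous extension; an atom of \<open>\<nu>\<close> there contributes a drift.\<close>

definition levy_kernel :: "real \<Rightarrow> real \<Rightarrow> complex" where
  "levy_kernel t x = (if x = 0 then \<i> * t else (iexp (t * x) - 1) / x)"

lemma levy_kernel_measurable [measurable]: "levy_kernel t \<in> borel_measurable borel"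
  unfolding levy_kernel_def[abs_def] by measurable

lemma levy_kernel_0 [simp]: "levy_kernel 0 x = 0"
  by (simp add: levy_kernel_def)

text \<open>The increment of \<open>iexp (t * x)\<close> in \<open>t\<close> carries a factor
  \<open>\<bar>x\<bar>\<close>, which the division by \<open>x\<close> cancels. The constant is
  therefore uniform in \<open>x\<close>, and the kernel can be differentiated under any probability
  law, whatever its moments.\<close>

lemma levy_kernel_lipschitz: "norm (levy_kernel s x - levy_kernel t x) \<le> \<bar>s - t\<bar>"
proof (cases "x = 0")
  case True
  then show ?thesis
    by (simp add: levy_kernel_def norm_mult flip: right_diff_distrib of_real_diff)
next
  case False
  have "norm (iexp (s * x) - iexp (t * x)) \<le> \<bar>s - t\<bar> * \<bar>x\<bar>"
    using norm_iexp_diff_le[of "s * x" "t * x"] by (simp add: abs_mult flip: left_diff_distrib)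
  with False show ?thesis
    by (simp add: levy_kernel_def norm_divide divide_simps flip: diff_divide_distrib)
qed

lemma norm_levy_kernel_le: "norm (levy_kernel t x) \<le> \<bar>t\<bar>"
  using levy_kernel_lipschitz[of t x 0] by simp

lemma has_vector_derivative_levy_kernel:
  "((\<lambda>s. levy_kernel s x) has_vector_derivative \<i> * iexp (t * x)) (at t)"
proof (cases "x = 0")
  case True
  then show ?thesis
    by (auto simp: levy_kernel_def intro!: derivative_eq_intros)
next
  case False
  have "((\<lambda>s. iexp (s * x)) has_vector_derivative x *\<^sub>R (\<i> * iexp (t * x))) (at t)"
  proof -
    have "((\<lambda>s. s * x) has_vector_derivative x) (at t)"
      by (auto intro!: derivative_eq_intros)
    from vector_diff_chain_at[OF this has_vector_derivative_iexp] show ?thesis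
      by (simp only: o_def)
  qed
  then have "((\<lambda>s. (iexp (s * x) - 1) / x) has_vector_derivative (x *\<^sub>R (\<i> * iexp (t * x)) - 0) / x) (at t)"
    by (intro derivative_intros)
  then show ?thesis
    using False by (simp add: levy_kernel_def scaleR_conv_of_real)
qed

text \<open>Second order Taylor estimate of \<open>iexp\<close>: the error is at most
  \<open>t\<^sup>2 * \<bar>x\<bar> / 2\<close>.\<close>

lemma tendsto_levy_kernel_0: "((\<lambda>x. levy_kernel t x) \<longlongrightarrow> \<i> * t) (at 0)"
proof -
  have "norm (levy_kernel t x - \<i> * t) \<le> t\<^sup>2 * \<bar>x\<bar> / 2" if "x \<noteq> 0" for x
  proof -
    have "norm (iexp (t * x) - 1 - \<i> * (t * x)) \<le> (t * x)\<^sup>2 / 2"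
      using iexp_approx1[of "t * x" 1] by (simp add: power2_eq_square diff_diff_eq)
    moreover have "levy_kernel t x - \<i> * t = (iexp (t * x) - 1 - \<i> * (t * x)) / x"
      using that by (simp add: levy_kernel_def field_simps)
    ultimately have "norm (levy_kernel t x - \<i> * t) \<le> (t * x)\<^sup>2 / 2 / \<bar>x\<bar>"
      by (simp only: norm_divide norm_of_real divide_right_mono abs_ge_zero)
    also have "\<dots> = t\<^sup>2 * \<bar>x\<bar> / 2"
      using that by (simp add: power_mult_distrib divide_simps power2_eq_square)
    finally show ?thesis .
  qed
  then have le: "\<forall>\<^sub>F x in at 0. norm (levy_kernel t x - \<i> * t) \<le> t\<^sup>2 * \<bar>x\<bar> / 2"
    by (auto simp: eventually_at_filter)
  have "((\<lambda>x. t\<^sup>2 * \<bar>x\<bar> / 2) \<longlongrightarrow> t\<^sup>2 * \<bar>0\<bar> / 2) (at 0)"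
    by (intro tendsto_intros) auto
  then have "((\<lambda>x. t\<^sup>2 * \<bar>x\<bar> / 2) \<longlongrightarrow> 0) (at 0)"
    by (simp only: abs_zero mult_zero_right div_0)
  then show ?thesis
    by (rule LIM_zero_cancel[OF Lim_null_comparison[OF le]])
qed

subsection \<open>Size biased laws and limits of nonnegative laws\<close>

definition levy_exponent :: "real measure \<Rightarrow> real \<Rightarrow> complex" where
  "levy_exponent \<nu> t = (\<integral>x. levy_kernel t x \<partial>\<nu>)"

lemma (in real_distribution) integrable_levy_kernel:
  assumes [measurable]: "g \<in> borel_measurable borel"
  shows "integrable M (\<lambda>x. levy_kernel t (g x))"
  by (rule integrable_const_bound[where B = "\<bar>t\<bar>"]) (auto simp: norm_levy_kernel_le)

lemma (in real_distribution) integrable_char: "integrable M (\<lambda>x. iexp (t * x))"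
  by (rule integrable_const_bound[where B = 1]) auto

lemma (in real_distribution) has_vector_derivative_levy_exponent:
  "(levy_exponent M has_vector_derivative \<i> * char M t) (at t)"
proof -
  have "((\<lambda>s. \<integral>x. levy_kernel s x \<partial>M) has_vector_derivative (\<integral>x. \<i> * iexp (t * x) \<partial>M)) (at t)"
    using levy_kernel_lipschitz
    by (intro has_vector_derivative_integral_lipschitz[where B = "\<lambda>_. 1"] integrable_levy_kernel
          has_vector_derivative_levy_kernel) auto
  then show ?thesis
    using integrable_char[of t] by (simp add: levy_exponent_def[abs_def] char_def)
qed

locale nonneg_distribution = real_distribution +
  assumes nonneg: "AE x in M. 0 \<le> x"

locale pos_mean_distribution = nonneg_distribution +
  assumes integrable_id: "integrable M (\<lambda>x. x)"
    and mean_pos: "0 < (\<integral>x. x \<partial>M)"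

lemma (in prob_space) nonneg_distribution_distr:
  assumes "X \<in> borel_measurable M" "AE \<omega> in M. 0 \<le> X \<omega>"
  shows "nonneg_distribution (distr M borel X)"
  using assms
  by (intro nonneg_distribution.intro nonneg_distribution_axioms.intro real_distribution_distr)
     (simp_all add: AE_distr_iff)

text \<open>A concrete version of the size biased law; \<open>size_biased_distr\<close> identifies
  every size biased variable with it. \<open>ennreal\<close> cuts negative arguments to 0, which is
  harmless for laws on the nonnegative reals.\<close>

definition size_law :: "real measure \<Rightarrow> real measure" where
  "size_law \<mu> = density \<mu> (\<lambda>x. ennreal (x / (\<integral>x. x \<partial>\<mu>)))"

context pos_mean_distribution
begin

lemma AE_size_density_nonneg: "AE x in M. 0 \<le> x / (\<integral>x. x \<partial>M)"
  using nonneg mean_pos by auto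

lemma nonneg_distribution_size_law: "nonneg_distribution (size_law M)"
proof -
  have "emeasure (size_law M) (space (size_law M)) = (\<integral>\<^sup>+x. ennreal (x / (\<integral>x. x \<partial>M)) \<partial>M)"
    by (simp add: size_law_def emeasure_density)
  also have "\<dots> = ennreal (\<integral>x. x / (\<integral>x. x \<partial>M) \<partial>M)"
    using integrable_id AE_size_density_nonneg by (intro nn_integral_eq_integral) auto
  also have "\<dots> = 1"
    using integrable_id mean_pos by simp
  finally interpret S: prob_space "size_law M"
    by (rule prob_spaceI)
  show ?thesis
  proof
    show "sets (size_law M) = sets borel"
      by (simp add: size_law_def)
    show "AE x in size_law M. 0 \<le> x"
      unfolding size_law_def using nonneg by (subst AE_density) (auto elim: eventually_mono)
  qed
qed

lemma integral_size_law:
  fixes f :: "real \<Rightarrow> 'b::{banach, second_countable_topology}"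
  assumes [measurable]: "f \<in> borel_measurable borel"
  shows "(\<integral>x. f x \<partial>size_law M) = (\<integral>x. x *\<^sub>R f x \<partial>M) /\<^sub>R (\<integral>x. x \<partial>M)"
proof -
  have "(\<integral>x. f x \<partial>size_law M) = (\<integral>x. (x / (\<integral>x. x \<partial>M)) *\<^sub>R f x \<partial>M)"
    unfolding size_law_def using AE_size_density_nonneg by (intro integral_density) auto
  also have "\<dots> = (\<integral>x. inverse (\<integral>x. x \<partial>M) *\<^sub>R (x *\<^sub>R f x) \<partial>M)"
    by (simp add: divide_inverse mult.commute)
  also have "\<dots> = (\<integral>x. x *\<^sub>R f x \<partial>M) /\<^sub>R (\<integral>x. x \<partial>M)"
    by (rule integral_scaleR_right)
  finally show ?thesis .
qed

lemma mean_mult_char_size_law: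
  "(\<integral>x. x \<partial>M) * char (size_law M) t = (\<integral>x. x * iexp (t * x) \<partial>M)"
  using mean_pos by (simp add: char_def integral_size_law scaleR_conv_of_real)

text \<open>Differentiation under the integral, dominated by \<open>\<bar>x\<bar>\<close>, produces
  a factor \<open>x\<close>, which the size bias absorbs.\<close>

lemma has_vector_derivative_char:
  "(char M has_vector_derivative \<i> * (\<integral>x. x \<partial>M) * char (size_law M) t) (at t)"
proof -
  have "((\<lambda>s. \<integral>x. iexp (s * x) \<partial>M) has_vector_derivative (\<integral>x. \<i> * (x * iexp (t * x)) \<partial>M)) (at t)"
  proof (rule has_vector_derivative_integral_lipschitz[where B = "\<lambda>x. \<bar>x\<bar>"])
    show "norm (iexp (s * x) - iexp (t * x)) \<le> \<bar>s - t\<bar> * \<bar>x\<bar>" for s x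
      using norm_iexp_diff_le[of "s * x" "t * x"] by (simp add: abs_mult flip: left_diff_distrib)
    show "((\<lambda>s. iexp (s * x)) has_vector_derivative \<i> * (x * iexp (t * x))) (at t)" for x
    proof -
      have "((\<lambda>s. s * x) has_vector_derivative x) (at t)"
        by (auto intro!: derivative_eq_intros)
      from vector_diff_chain_at[OF this has_vector_derivative_iexp] show ?thesis
        by (simp only: o_def scaleR_conv_of_real mult.left_commute)
    qed
    show "integrable M (\<lambda>x. \<bar>x\<bar>)"
      using integrable_id by (rule integrable_abs)
  qed (rule integrable_char, measurable)
  also have "(\<integral>x. \<i> * (x * iexp (t * x)) \<partial>M) = \<i> * (\<integral>x. x * iexp (t * x) \<partial>M)"
    by (rule integral_mult_right_zero)
  finally show ?thesis
    by (simp only: mult.assoc mean_mult_char_size_law) (simp only: char_def[abs_def])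
qed

text \<open>Substituting \<open>eq\<close> into the derivative of \<open>char M\<close> gives a
  linear equation whose coefficient has the antiderivative \<open>H\<close>. The case
  \<open>c = 1\<close> serves the size biased relation; a general \<open>c\<close>, with the drift
  coming from \<open>1 - c\<close>, serves the zero biased one.\<close>

lemma char_eq_exp_levy_exponent:
  assumes "real_distribution \<nu>"
    and eq: "\<And>t. char (size_law M) t = char M t * (1 + of_real c * (char \<nu> t - 1))"
  shows "char M t =
    exp (of_real (\<integral>x. x \<partial>M) * (of_real c * levy_exponent \<nu> t + \<i> * of_real ((1 - c) * t)))"
proof -
  interpret \<nu>: real_distribution \<nu> by fact
  define m where "m = complex_of_real (\<integral>x. x \<partial>M)"
  define H where "H t = m * (of_real c * levy_exponent \<nu> t + \<i> * of_real ((1 - c) * t))" for t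
  have F: "(char M has_vector_derivative
      char M t * (\<i> * m * (1 + of_real c * (char \<nu> t - 1)))) (at t)" for t
    using has_vector_derivative_char[of t] by (simp add: eq m_def mult_ac)
  have H: "(H has_vector_derivative \<i> * m * (1 + of_real c * (char \<nu> t - 1))) (at t)" for t
    unfolding H_def[abs_def]
    by (auto intro!: derivative_eq_intros \<nu>.has_vector_derivative_levy_exponent simp: algebra_simps)
  have H0: "H 0 = 0"
    by (simp add: H_def levy_exponent_def)
  show ?thesis
    unfolding m_def[symmetric] H_def[symmetric]
    by (rule exp_unique_ode[OF F H char_zero H0])
qed

end

text \<open>For nonnegative laws uniformly small right tails already give tightness, hence a weakly
  convergent subsequence, and weak convergence carries over to characteristic functions.\<close>

lemma nonneg_distribution_char_subseq:
  fixes \<rho> :: "nat \<Rightarrow> real measure"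
  assumes \<rho>: "\<And>n. nonneg_distribution (\<rho> n)"
    and tail: "\<And>e. 0 < e \<Longrightarrow> \<exists>b. \<forall>n. measure (\<rho> n) {b<..} < e"
  obtains r \<nu> where "strict_mono r" "nonneg_distribution \<nu>"
    "\<And>t. (\<lambda>n. char (\<rho> (r n)) t) \<longlonglongrightarrow> char \<nu> t"
proof -
  interpret \<rho>: nonneg_distribution "\<rho> n" for n by fact
  have rd: "real_distribution (\<rho> n)" for n ..
  have "tight \<rho>"
    unfolding tight_def
  proof (intro conjI allI impI rd)
    fix e :: real assume "0 < e"
    then obtain b where b: "\<And>n. measure (\<rho> n) {b<..} < e"
      using tail by blast
    \<comment> \<open>The left end \<open>-1\<close> keeps a possible atom at 0 inside the half-open
      interval; \<open>max b 0\<close> makes the interval nonempty when \<open>b\<close> is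
      negative.\<close>
    have "1 - e < measure (\<rho> n) {-1<..max b 0}" for n
    proof -
      have "measure (\<rho> n) (- {-1<..max b 0}) \<le> measure (\<rho> n) {b<..}"
      proof (rule \<rho>.finite_measure_mono_AE)
        show "AE x in \<rho> n. x \<in> - {- 1<..max b 0} \<longrightarrow> x \<in> {b<..}"
          using \<rho>.nonneg[of n] by eventually_elim auto
      qed simp
      also have "\<dots> < e" by (rule b)
      finally show ?thesis
        using \<rho>.prob_compl[of "{-1<..max b 0}" n] by (simp add: Compl_eq_Diff_UNIV)
    qed
    then show "\<exists>a b. a < b \<and> (\<forall>n. 1 - e < measure (\<rho> n) {a<..b})"
      by (intro exI[of _ "-1"] exI[of _ "max b 0"]) auto
  qed
  from tight_imp_convergent_subsubsequence[OF this strict_mono_id]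
  obtain r \<nu> where r: "strict_mono r" and "real_distribution \<nu>" and w: "weak_conv_m (\<rho> \<circ> r) \<nu>"
    by auto
  interpret \<nu>: real_distribution \<nu> by fact
  have rd': "\<And>n. real_distribution ((\<rho> \<circ> r) n)"
    using rd by simp
  have "(\<lambda>n. char (\<rho> (r n)) t) \<longlonglongrightarrow> char \<nu> t" for t
    using levy_continuity1[OF rd' _ w] \<open>real_distribution \<nu>\<close> by (simp add: o_def)
  moreover have "AE x in \<nu>. 0 \<le> x"
  proof -
    \<comment> \<open>A bounded continuous function that is positive exactly on the negative reals:
      its integrals vanish along the sequence, hence in the limit.\<close>
    define f :: "real \<Rightarrow> real" where "f x = min 1 (max 0 (- x))" for x
    have [measurable]: "f \<in> borel_measurable borel"
      unfolding f_def[abs_def] by measurable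
    have "(\<lambda>n. \<integral>x. f x \<partial>(\<rho> \<circ> r) n) \<longlonglongrightarrow> (\<integral>x. f x \<partial>\<nu>)"
    proof (rule weak_conv_imp_integral_bdd_continuous_conv[OF rd' _ w])
      show "isCont f x" for x
        unfolding f_def[abs_def] by (intro continuous_intros)
      show "norm (f x) \<le> 1" for x
        by (simp add: f_def)
    qed fact
    moreover have "(\<integral>x. f x \<partial>(\<rho> \<circ> r) n) = 0" for n
    proof (rule integral_eq_zero_AE)
      show "AE x in (\<rho> \<circ> r) n. f x = 0"
        unfolding o_def using \<rho>.nonneg[of "r n"] by eventually_elim (simp add: f_def)
    qed
    ultimately have "(\<integral>x. f x \<partial>\<nu>) = 0"
      by (simp add: LIMSEQ_const_iff)
    moreover have "integrable \<nu> f"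
      by (rule \<nu>.integrable_const_bound[where B = 1]) (auto simp: f_def)
    ultimately have "AE x in \<nu>. f x = 0"
      by (subst (asm) integral_nonneg_eq_0_iff_AE) (auto simp: f_def)
    then show ?thesis
      by eventually_elim (auto simp: f_def min_def max_def split: if_splits)
  qed
  ultimately show ?thesis
    using \<open>real_distribution \<nu>\<close> r
    by (intro that[of r \<nu>] nonneg_distribution.intro nonneg_distribution_axioms.intro)
qed

section \<open>Laws of sums of independent copies\<close>

abbreviation iid_sum_law :: "nat \<Rightarrow> real measure \<Rightarrow> real measure" where
  "iid_sum_law n \<nu> \<equiv> distr (\<Pi>\<^sub>M i\<in>{..<n}. \<nu>) borel (\<lambda>x. \<Sum>i<n. x i)"

lemma distr_PiM_component_borel:
  assumes "real_distribution \<nu>" and "i \<in> I"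
  shows "distr (\<Pi>\<^sub>M i\<in>I. \<nu>) borel (\<lambda>x. x i) = \<nu>"
proof -
  interpret \<nu>: real_distribution \<nu> by fact
  have "distr (\<Pi>\<^sub>M i\<in>I. \<nu>) borel (\<lambda>x. x i) = distr (\<Pi>\<^sub>M i\<in>I. \<nu>) \<nu> (\<lambda>x. x i)"
    by (rule distr_cong) auto
  also have "\<dots> = \<nu>"
    using \<open>i \<in> I\<close> \<nu>.prob_space_axioms by (intro distr_PiM_component) auto
  finally show ?thesis .
qed

text \<open>Under the product measure the joint law of the coordinates is the product of their laws,
  so they are independent and the characteristic functions multiply.\<close>

lemma char_iid_sum:
  assumes "real_distribution \<nu>" and "0 < n"
  shows "char (iid_sum_law n \<nu>) t = char \<nu> t ^ n"
proof -
  interpret \<nu>: real_distribution \<nu> by fact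
  interpret P: prob_space "\<Pi>\<^sub>M i\<in>{..<n}. \<nu>"
    by (rule prob_space_PiM) (rule \<nu>.prob_space_axioms)
  have comp: "distr (\<Pi>\<^sub>M i\<in>{..<n}. \<nu>) borel (\<lambda>x. x i) = \<nu>" if "i < n" for i
    by (rule distr_PiM_component_borel) (use assms that in auto)
  have "P.indep_vars (\<lambda>_. borel) (\<lambda>i x. x i) {..<n}"
  proof (subst P.indep_vars_iff_distr_eq_PiM')
    have "distr (\<Pi>\<^sub>M i\<in>{..<n}. \<nu>) (\<Pi>\<^sub>M i\<in>{..<n}. borel) (\<lambda>x. \<lambda>i\<in>{..<n}. x i) =
        distr (\<Pi>\<^sub>M i\<in>{..<n}. \<nu>) (\<Pi>\<^sub>M i\<in>{..<n}. \<nu>) (\<lambda>x. x)"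
      by (rule distr_cong) (auto simp: space_PiM PiE_def extensional_restrict intro!: sets_PiM_cong)
    also have "\<dots> = (\<Pi>\<^sub>M i\<in>{..<n}. distr (\<Pi>\<^sub>M i\<in>{..<n}. \<nu>) borel (\<lambda>x. x i))"
      unfolding distr_id by (rule PiM_cong) (auto simp: comp)
    finally show "distr (\<Pi>\<^sub>M i\<in>{..<n}. \<nu>) (\<Pi>\<^sub>M i\<in>{..<n}. borel) (\<lambda>x. \<lambda>i\<in>{..<n}. x i) =
        (\<Pi>\<^sub>M i\<in>{..<n}. distr (\<Pi>\<^sub>M i\<in>{..<n}. \<nu>) borel (\<lambda>x. x i))" .
  qed (use \<open>0 < n\<close> in auto)
  then have "char (iid_sum_law n \<nu>) t =
      (\<Prod>i<n. char (distr (\<Pi>\<^sub>M i\<in>{..<n}. \<nu>) borel (\<lambda>x. x i)) t)"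
    by (rule P.char_distr_sum)
  then show ?thesis
    by (simp add: comp)
qed

subsection \<open>Infinitely divisible laws from their exponents\<close>

lemma real_distribution_iid_sum_law:
  assumes "real_distribution \<nu>"
  shows "real_distribution (iid_sum_law n \<nu>)"
proof -
  interpret \<nu>: real_distribution \<nu> by fact
  interpret P: prob_space "\<Pi>\<^sub>M i\<in>{..<n}. \<nu>"
    by (rule prob_space_PiM) (rule \<nu>.prob_space_axioms)
  show ?thesis
    by (rule P.real_distribution_distr) measurable
qed

lemma integral_PiM_component:
  fixes f :: "real \<Rightarrow> 'b::{banach, second_countable_topology}"
  assumes "real_distribution \<nu>" "i \<in> I" "f \<in> borel_measurable borel"
  shows "integrable (\<Pi>\<^sub>M i\<in>I. \<nu>) (\<lambda>x. f (x i)) \<longleftrightarrow> integrable \<nu> f"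
    and "(\<integral>x. f (x i) \<partial>(\<Pi>\<^sub>M i\<in>I. \<nu>)) = (\<integral>x. f x \<partial>\<nu>)"
proof -
  interpret \<nu>: real_distribution \<nu> by fact
  have m: "(\<lambda>x. x i) \<in> borel_measurable (\<Pi>\<^sub>M i\<in>I. \<nu>)"
    using \<open>i \<in> I\<close> by measurable
  show "integrable (\<Pi>\<^sub>M i\<in>I. \<nu>) (\<lambda>x. f (x i)) \<longleftrightarrow> integrable \<nu> f"
    using integrable_distr_eq[OF m assms(3)] distr_PiM_component_borel[OF assms(1,2)] by simp
  show "(\<integral>x. f (x i) \<partial>(\<Pi>\<^sub>M i\<in>I. \<nu>)) = (\<integral>x. f x \<partial>\<nu>)"
    using integral_distr[OF m assms(3)] distr_PiM_component_borel[OF assms(1,2)] by simp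
qed

lemma (in nonneg_distribution) AE_PiM_nonneg:
  "AE x in (\<Pi>\<^sub>M i\<in>{..<n::nat}. M). \<forall>i<n. 0 \<le> x i"
proof -
  have "AE x in (\<Pi>\<^sub>M i\<in>{..<n}. M). 0 \<le> x i" if "i < n" for i
    using that nonneg by (intro AE_PiM_component prob_space_axioms) auto
  then have "AE x in (\<Pi>\<^sub>M i\<in>{..<n}. M). \<forall>i\<in>{..<n}. 0 \<le> x i"
    by (intro AE_finite_allI) auto
  then show ?thesis
    by (simp add: lessThan_def)
qed

lemma (in nonneg_distribution) nonneg_distribution_iid_sum_law:
  "nonneg_distribution (iid_sum_law n M)"
proof -
  interpret P: prob_space "\<Pi>\<^sub>M i\<in>{..<n}. M"
    by (rule prob_space_PiM) (rule prob_space_axioms)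
  show ?thesis
  proof (rule P.nonneg_distribution_distr)
    show "AE x in (\<Pi>\<^sub>M i\<in>{..<n}. M). 0 \<le> (\<Sum>i<n. x i)"
      using AE_PiM_nonneg[of n] by eventually_elim (auto intro: sum_nonneg)
  qed measurable
qed

text \<open>Markov's inequality. The bound depends only on the total mean, so it is uniform over
  sums of ever more and ever smaller summands with a fixed total mean.\<close>

lemma (in nonneg_distribution) iid_sum_law_tail_le:
  assumes int: "integrable M (\<lambda>x. x)" and "0 < b"
  shows "measure (iid_sum_law n M) {b<..} \<le> n * (\<integral>x. x \<partial>M) / b"
proof -
  have rd: "real_distribution M" ..
  interpret S: nonneg_distribution "iid_sum_law n M"
    by (rule nonneg_distribution_iid_sum_law)
  have [measurable]: "(\<lambda>x. \<Sum>i<n. x i) \<in> borel_measurable (\<Pi>\<^sub>M i\<in>{..<n}. M)"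
    by measurable
  have int_i: "integrable (\<Pi>\<^sub>M i\<in>{..<n}. M) (\<lambda>x. x i)" if "i < n" for i
  proof (rule integral_PiM_component(1)[OF rd, of i "{..<n}" "\<lambda>x. x", THEN iffD2])
    show "i \<in> {..<n}" using that by simp
    show "(\<lambda>x::real. x) \<in> borel_measurable borel" by measurable
  qed (rule int)
  have "integrable (\<Pi>\<^sub>M i\<in>{..<n}. M) (\<lambda>x. \<Sum>i<n. x i)"
    using int_i by (intro Bochner_Integration.integrable_sum) simp
  then have "integrable (iid_sum_law n M) (\<lambda>x. x)"
    by (simp add: integrable_distr_eq)
  then have "measure (iid_sum_law n M) {x \<in> space (iid_sum_law n M). b \<le> x} \<le> (\<integral>x. x \<partial>iid_sum_law n M) / b"
    using S.nonneg \<open>0 < b\<close> by (intro integral_Markov_inequality_measure[where A = "{}"]) auto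
  also have "(\<integral>x. x \<partial>iid_sum_law n M) = (\<integral>x. (\<Sum>i<n. x i) \<partial>(\<Pi>\<^sub>M i\<in>{..<n}. M))"
    by (subst integral_distr) auto
  also have "\<dots> = (\<Sum>i<n. \<integral>x. x i \<partial>(\<Pi>\<^sub>M i\<in>{..<n}. M))"
    using int_i by (intro Bochner_Integration.integral_sum) auto
  also have "\<dots> = n * (\<integral>x. x \<partial>M)"
  proof -
    have "(\<integral>x. x i \<partial>(\<Pi>\<^sub>M i\<in>{..<n}. M)) = (\<integral>x. x \<partial>M)" if "i < n" for i
      by (rule integral_PiM_component(2)[OF rd, of i "{..<n}" "\<lambda>x. x"]) (use that in simp_all)
    then show ?thesis by simp
  qed
  finally have "measure (iid_sum_law n M) {x. b \<le> x} \<le> n * (\<integral>x. x \<partial>M) / b"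
    by simp
  moreover have "measure (iid_sum_law n M) {b<..} \<le> measure (iid_sum_law n M) {x. b \<le> x}"
    by (rule S.finite_measure_mono) auto
  ultimately show ?thesis
    by linarith
qed

section \<open>Approximation by sums of thinned jumps\<close>

abbreviation unit_uniform :: "real measure" where
  "unit_uniform \<equiv> uniform_measure lborel {0..1}"

text \<open>The jump size \<open>y = max x d\<close> is kept with probability \<open>d / y\<close> and replaced by 0 otherwise,
  so that the mean is \<open>d\<close>: superposing \<open>n\<close> such jumps with \<open>d = c / n\<close> approximates a
  subordinator with Levy measure \<open>c \<nu>(dx) / x\<close>, an atom of \<open>\<nu>\<close> at 0 becoming a drift.\<close>

definition thinned_law :: "real \<Rightarrow> real measure \<Rightarrow> real measure" where
  "thinned_law d \<nu> = distr (\<nu> \<Otimes>\<^sub>M unit_uniform) borel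
     (\<lambda>(x, u). if u \<le> d / max x d then max x d else 0)"

lemma prob_space_unit_uniform: "prob_space unit_uniform"
  by (rule prob_space_uniform_measure) auto

lemma measure_unit_uniform:
  assumes "0 \<le> p" "p \<le> 1"
  shows "measure unit_uniform {..p} = p"
proof -
  have "{0..1} \<inter> {..p} = {0..p}"
    using assms by auto
  then show ?thesis
    using assms by simp
qed

context real_distribution
begin

lemma nonneg_distribution_thinned_law:
  assumes "0 < d"
  shows "nonneg_distribution (thinned_law d M)"
proof -
  interpret U: prob_space unit_uniform by (rule prob_space_unit_uniform)
  interpret P: pair_prob_space M unit_uniform ..
  show ?thesis
    unfolding thinned_law_def using assms
    by (intro P.nonneg_distribution_distr) (auto simp: case_prod_unfold)
qed

text \<open>Given \<open>x\<close>, a jump of size \<open>max x d\<close> is kept with probability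
  \<open>d / max x d\<close>, so the conditional mean is \<open>d\<close> whatever \<open>x\<close>
  is. The nonnegative integral is computed first and gives integrability as well.\<close>

lemma integrable_thinned_law:
  assumes "0 < d"
  shows "integrable (thinned_law d M) (\<lambda>x. x)" "(\<integral>x. x \<partial>thinned_law d M) = d"
proof -
  interpret U: prob_space unit_uniform by (rule prob_space_unit_uniform)
  interpret P: pair_prob_space M unit_uniform ..
  interpret T: nonneg_distribution "thinned_law d M"
    using assms by (rule nonneg_distribution_thinned_law)
  have "(\<integral>\<^sup>+x. ennreal x \<partial>thinned_law d M) =
      (\<integral>\<^sup>+z. ennreal (case z of (x, u) \<Rightarrow> if u \<le> d / max x d then max x d else 0) \<partial>(M \<Otimes>\<^sub>M unit_uniform))"
    unfolding thinned_law_def by (subst nn_integral_distr) auto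
  also have "\<dots> = (\<integral>\<^sup>+x. \<integral>\<^sup>+u. ennreal (if u \<le> d / max x d then max x d else 0) \<partial>unit_uniform \<partial>M)"
    by (subst U.nn_integral_fst[symmetric]) auto
  also have "\<dots> = (\<integral>\<^sup>+x. ennreal d \<partial>M)"
  proof (rule nn_integral_cong)
    fix x
    have "(\<integral>\<^sup>+u. ennreal (if u \<le> d / max x d then max x d else 0) \<partial>unit_uniform) =
        (\<integral>\<^sup>+u. ennreal (max x d) * indicator {..d / max x d} u \<partial>unit_uniform)"
      by (rule nn_integral_cong) (auto split: split_indicator)
    also have "\<dots> = ennreal (max x d) * emeasure unit_uniform {..d / max x d}"
      by (subst nn_integral_cmult_indicator) auto
    also have "\<dots> = ennreal (max x d) * ennreal (d / max x d)"
      using assms by (subst U.emeasure_eq_measure, subst measure_unit_uniform) auto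
    also have "\<dots> = ennreal d"
      using assms by (subst ennreal_mult[symmetric]) auto
    finally show "(\<integral>\<^sup>+u. ennreal (if u \<le> d / max x d then max x d else 0) \<partial>unit_uniform) = ennreal d" .
  qed
  also have "\<dots> = ennreal d"
    using emeasure_space_1 by simp
  finally have nn: "(\<integral>\<^sup>+x. ennreal x \<partial>thinned_law d M) = ennreal d" .
  then show "integrable (thinned_law d M) (\<lambda>x. x)"
    using T.nonneg by (intro integrableI_nn_integral_finite) auto
  show "(\<integral>x. x \<partial>thinned_law d M) = d"
    using nn T.nonneg assms by (subst integral_eq_nn_integral) auto
qed

text \<open>Given \<open>x\<close> and with \<open>y = max x d\<close>, the outcome differs from 0
  with probability \<open>d / y\<close> and then adds \<open>iexp (t * y) - 1\<close>; the product
  is \<open>d\<close> times the Levy kernel at \<open>y\<close>. As \<open>y\<close> is positive,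
  only the quotient branch of the kernel occurs.\<close>

lemma char_thinned_law:
  assumes "0 < d"
  shows "char (thinned_law d M) t = 1 + d * (\<integral>x. levy_kernel t (max x d) \<partial>M)"
proof -
  interpret U: prob_space unit_uniform by (rule prob_space_unit_uniform)
  interpret P: pair_prob_space M unit_uniform ..
  have "char (thinned_law d M) t =
      (\<integral>(x, u). iexp (t * (if u \<le> d / max x d then max x d else 0)) \<partial>(M \<Otimes>\<^sub>M unit_uniform))"
    unfolding thinned_law_def char_def by (subst integral_distr) (auto simp: case_prod_unfold)
  also have "\<dots> = (\<integral>x. \<integral>u. iexp (t * (if u \<le> d / max x d then max x d else 0)) \<partial>unit_uniform \<partial>M)"
    by (rule P.integral_fst[symmetric], rule P.P.integrable_const_bound[where B = 1]) auto
  also have "\<dots> = (\<integral>x. 1 + d * levy_kernel t (max x d) \<partial>M)"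
  proof (rule Bochner_Integration.integral_cong[OF refl])
    fix x
    let ?p = "d / max x d" and ?e = "iexp (t * max x d)"
    have "(\<integral>u. iexp (t * (if u \<le> ?p then max x d else 0)) \<partial>unit_uniform) =
        (\<integral>u. 1 + indicator {..?p} u *\<^sub>R (?e - 1) \<partial>unit_uniform)"
      by (intro Bochner_Integration.integral_cong) (auto split: split_indicator)
    also have "\<dots> = 1 + measure unit_uniform {..?p} *\<^sub>R (?e - 1)"
      by (subst Bochner_Integration.integral_add)
         (auto simp: U.prob_space U.emeasure_eq_measure)
    also have "\<dots> = 1 + d * levy_kernel t (max x d)"
      using assms by (subst measure_unit_uniform) (auto simp: levy_kernel_def scaleR_conv_of_real)
    finally show "(\<integral>u. iexp (t * (if u \<le> ?p then max x d else 0)) \<partial>unit_uniform) = 1 + d * levy_kernel t (max x d)" .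
  qed
  also have "\<dots> = 1 + d * (\<integral>x. levy_kernel t (max x d) \<partial>M)"
    using integrable_levy_kernel[of "\<lambda>x. max x d" t] prob_space
    by (subst Bochner_Integration.integral_add) auto
  finally show ?thesis .
qed

end

text \<open>Dominated convergence with bound \<open>\<bar>t\<bar>\<close>. At \<open>x > 0\<close>
  the truncation is eventually inactive; at \<open>x = 0\<close> the kernel is evaluated along
  positive points tending to 0, where it tends to its value at 0.\<close>

lemma (in nonneg_distribution) tendsto_levy_exponent_truncated:
  assumes "0 < c"
  shows "(\<lambda>k. \<integral>x. levy_kernel t (max x (c / Suc k)) \<partial>M) \<longlonglongrightarrow> levy_exponent M t"
  unfolding levy_exponent_def
proof (rule integral_dominated_convergence[where w = "\<lambda>_. \<bar>t\<bar>"])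
  have d: "(\<lambda>k. c / Suc k) \<longlonglongrightarrow> 0"
    using LIMSEQ_Suc[OF tendsto_divide_0[OF tendsto_const filterlim_at_top_imp_at_infinity[OF filterlim_real_sequentially]]]
    by simp
  show "AE x in M. (\<lambda>k. levy_kernel t (max x (c / Suc k))) \<longlonglongrightarrow> levy_kernel t x"
    using nonneg
  proof eventually_elim
    case (elim x)
    show ?case
    proof (cases "x = 0")
      case True
      have "filterlim (\<lambda>k. c / Suc k) (at 0) sequentially"
        using d assms by (auto simp: filterlim_at)
      from filterlim_compose[OF tendsto_levy_kernel_0 this] show ?thesis
        using True assms by (simp add: levy_kernel_def max_absorb2)
    next
      case False
      with elim have "0 < x" by simp
      then have "\<forall>\<^sub>F k in sequentially. c / Suc k < x"
        using d by (intro order_tendstoD(2)) auto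
      then have "\<forall>\<^sub>F k in sequentially. levy_kernel t x = levy_kernel t (max x (c / Suc k))"
        by eventually_elim (simp add: max_absorb1)
      then show ?thesis
        by (rule Lim_transform_eventually[OF tendsto_const])
    qed
  qed
qed (auto simp: norm_levy_kernel_le)

text \<open>The sum of \<open>k + 1\<close> thinned jumps with \<open>d = c / (k + 1)\<close> has
  characteristic function \<open>(1 + z / (k + 1)) ^ (k + 1)\<close> with \<open>z\<close> tending
  to \<open>c * levy_exponent M t\<close>. All these sums have mean \<open>c\<close>, so they are
  tight and the limit is again a characteristic function.\<close>

lemma (in nonneg_distribution) ex_char_exp_levy_exponent:
  assumes "0 < c"
  obtains \<rho> where "real_distribution \<rho>" "\<And>t. char \<rho> t = exp (of_real c * levy_exponent M t)"
proof -
  define \<rho> where "\<rho> k = iid_sum_law (Suc k) (thinned_law (c / Suc k) M)" for k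
  have pos: "0 < c / Suc k" for k
    using assms by simp
  interpret T: nonneg_distribution "thinned_law (c / Suc k) M" for k
    by (rule nonneg_distribution_thinned_law[OF pos])
  have rd: "real_distribution (thinned_law (c / Suc k) M)" for k ..
  have conv: "(\<lambda>n. char (\<rho> n) t) \<longlonglongrightarrow> exp (of_real c * levy_exponent M t)" for t
  proof -
    have "char (\<rho> n) t = (1 + (of_real c * (\<integral>x. levy_kernel t (max x (c / Suc n)) \<partial>M)) / of_nat (Suc n)) ^ Suc n" for n
      unfolding \<rho>_def char_iid_sum[OF rd zero_less_Suc] char_thinned_law[OF pos]
      by (simp del: of_nat_Suc power_Suc)
    moreover have "(\<lambda>n. of_real c * (\<integral>x. levy_kernel t (max x (c / Suc n)) \<partial>M)) \<longlonglongrightarrow>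
        of_real c * levy_exponent M t"
      using assms by (intro tendsto_mult tendsto_const tendsto_levy_exponent_truncated)
    ultimately show ?thesis
      using tendsto_one_plus_div_power_exp by presburger
  qed
  obtain r \<nu> where r: "strict_mono r" and \<nu>: "nonneg_distribution \<nu>"
    and lim: "\<And>t. (\<lambda>n. char (\<rho> (r n)) t) \<longlonglongrightarrow> char \<nu> t"
  proof (rule nonneg_distribution_char_subseq[of \<rho>])
    show "nonneg_distribution (\<rho> n)" for n
      unfolding \<rho>_def by (rule T.nonneg_distribution_iid_sum_law)
    show "\<exists>b. \<forall>n. measure (\<rho> n) {b<..} < e" if "0 < e" for e
    proof (intro exI allI)
      fix n
      \<comment> \<open>The threshold \<open>2 * c / e\<close> turns Markov's bound into
        \<open>e / 2\<close>, strictly below \<open>e\<close>.\<close>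
      have "measure (\<rho> n) {2 * c / e<..} \<le> Suc n * (c / Suc n) / (2 * c / e)"
        using T.iid_sum_law_tail_le[of n "2 * c / e" "Suc n"] integrable_thinned_law[OF pos, of n] assms that
        by (simp add: \<rho>_def del: of_nat_Suc)
      also have "\<dots> = e / 2"
        using assms by simp
      finally show "measure (\<rho> n) {2 * c / e<..} < e"
        using that by simp
    qed
  qed (rule that)
  have "char \<nu> t = exp (of_real c * levy_exponent M t)" for t
    using LIMSEQ_unique[OF lim] LIMSEQ_subseq_LIMSEQ[OF conv r] by (simp add: o_def)
  with \<nu> show ?thesis
    by (intro that[of \<nu>]) (auto simp: nonneg_distribution_def)
qed

text \<open>An exponent of this form is divided by \<open>n\<close> by dividing \<open>a\<close> and
  \<open>b\<close>: the root is the law with coefficient \<open>a / n\<close>, translated by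
  \<open>b / n\<close>. Realising the drift as a translation allows \<open>b\<close> to be
  negative.\<close>

lemma infinitely_divisible_char_exp:
  assumes "real_distribution \<mu>" "nonneg_distribution \<nu>" "0 < a"
    and char: "\<And>t. char \<mu> t = exp (of_real a * levy_exponent \<nu> t + \<i> * of_real (b * t))"
  shows "infinitely_divisible \<mu>"
  unfolding infinitely_divisible_def
proof (intro allI impI)
  fix n :: nat assume "1 \<le> n"
  interpret \<nu>: nonneg_distribution \<nu> by fact
  obtain \<rho> where \<rho>: "real_distribution \<rho>" "\<And>t. char \<rho> t = exp (of_real (a / n) * levy_exponent \<nu> t)"
    using \<nu>.ex_char_exp_levy_exponent[of "a / n"] \<open>0 < a\<close> \<open>1 \<le> n\<close> by (metis divide_pos_pos of_nat_0_less_iff less_le_trans zero_less_one)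
  interpret \<rho>: real_distribution \<rho> by (rule \<rho>)
  define \<rho>' where "\<rho>' = distr \<rho> borel (\<lambda>x. x + b / n)"
  interpret \<rho>': real_distribution \<rho>'
    unfolding \<rho>'_def by (rule \<rho>.real_distribution_distr) simp
  have rd: "real_distribution \<rho>'" ..
  have "char \<rho>' t = exp (\<i> * of_real (t * (b / n))) * char \<rho> t" for t
  proof -
    have "char \<rho>' t = (\<integral>x. iexp (t * (x + b / n)) \<partial>\<rho>)"
      unfolding \<rho>'_def char_def by (subst integral_distr) auto
    also have "\<dots> = (\<integral>x. iexp (t * (b / n)) * iexp (t * x) \<partial>\<rho>)"
      by (simp add: algebra_simps flip: exp_add)
    also have "\<dots> = iexp (t * (b / n)) * char \<rho> t"
      unfolding char_def by (rule integral_mult_right_zero)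
    finally show ?thesis .
  qed
  moreover have "of_nat n * (\<i> * of_real (t * (b / n)) + of_real (a / n) * levy_exponent \<nu> t) =
      of_real a * levy_exponent \<nu> t + \<i> * of_real (b * t)" for t
    using \<open>1 \<le> n\<close> by (simp add: field_simps)
  ultimately have "char (iid_sum_law n \<rho>') t = char \<mu> t" for t
    using \<open>1 \<le> n\<close>
    by (simp add: char_iid_sum[OF rd] \<rho>(2) char del: of_real_mult of_real_divide flip: exp_add exp_of_nat_mult)
  then have "iid_sum_law n \<rho>' = \<mu>"
    by (intro Levy_uniqueness real_distribution_iid_sum_law rd assms) auto
  then show "\<exists>\<nu>::real measure. prob_space \<nu> \<and> sets \<nu> = sets borel \<and> iid_sum_law n \<nu> = \<mu>"
    by (intro exI[of _ \<rho>'] conjI \<rho>'.prob_space_axioms) auto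
qed

subsection \<open>Convolution roots\<close>

text \<open>Applied to the convolution roots of a fixed law, whose means are of order
  \<open>1 / n\<close>, this drives their characteristic functions to 1.\<close>

lemma (in pos_mean_distribution) norm_char_minus_1_le: "norm (char M t - 1) \<le> \<bar>t\<bar> * (\<integral>x. x \<partial>M)"
proof -
  have "norm (char M t - 1) = norm (\<integral>x. iexp (t * x) - 1 \<partial>M)"
    using integrable_char[of t] prob_space by (simp add: char_def)
  also have "\<dots> \<le> (\<integral>x. norm (iexp (t * x) - 1) \<partial>M)"
    by (rule integral_norm_bound)
  also have "\<dots> \<le> (\<integral>x. \<bar>t\<bar> * x \<partial>M)"
  proof (rule integral_mono_AE)
    show "integrable M (\<lambda>x. norm (iexp (t * x) - 1))"
      by (intro integrable_norm Bochner_Integration.integrable_diff integrable_char) simp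
    show "integrable M (\<lambda>x. \<bar>t\<bar> * x)"
      using integrable_id by simp
    show "AE x in M. norm (iexp (t * x) - 1) \<le> \<bar>t\<bar> * x"
      using nonneg
    proof eventually_elim
      case (elim x)
      then show ?case
        using norm_iexp_diff_le[of "t * x" 0] by (simp add: abs_mult)
    qed
  qed
  finally show ?thesis by simp
qed

text \<open>If one summand were negative with positive probability, independence would make all of
  them, and so the sum, negative with positive probability. Once the summands are nonnegative, each
  is dominated by the sum, hence integrable, and the mean is additive.\<close>

lemma iid_sum_law_root:
  assumes M: "pos_mean_distribution M" and \<nu>: "real_distribution \<nu>"
    and eq: "iid_sum_law n \<nu> = M" and "0 < n"
  shows "pos_mean_distribution \<nu>" and "n * (\<integral>x. x \<partial>\<nu>) = (\<integral>x. x \<partial>M)"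
proof -
  interpret M: pos_mean_distribution M by fact
  interpret \<nu>: real_distribution \<nu> by fact
  let ?P = "\<Pi>\<^sub>M i\<in>{..<n}. \<nu>"
  interpret P: product_prob_space "\<lambda>_. \<nu>" "{..<n}"
    by standard
  have sum_m: "(\<lambda>x. \<Sum>i<n. x i) \<in> borel_measurable ?P"
    by measurable
  have AE_sum: "AE x in ?P. 0 \<le> (\<Sum>i<n. x i)"
    using M.nonneg unfolding eq[symmetric] by (subst (asm) AE_distr_iff[OF sum_m]) auto
  \<comment> \<open>The event that all coordinates are negative; its probability is the
    \<open>n\<close>-th power of that of a single negative coordinate.\<close>
  define A where "A = (\<Pi>\<^sub>E i\<in>{..<n}. {..<0::real})"
  have A: "A \<in> sets ?P"
    unfolding A_def by (rule sets_PiM_I_finite) auto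
  have "AE x in ?P. x \<notin> A"
    using AE_sum
  proof eventually_elim
    case (elim x)
    have "(\<Sum>i<n. x i) < (\<Sum>i<n. 0)" if "x \<in> A"
      using that \<open>0 < n\<close> by (intro sum_strict_mono) (auto simp: A_def PiE_iff)
    with elim show ?case by auto
  qed
  then have "emeasure ?P A = 0"
    using A by (simp add: AE_iff_null_sets[symmetric] null_setsD1)
  moreover have "emeasure ?P A = emeasure \<nu> {..<0} ^ n"
    unfolding A_def by (subst P.emeasure_PiM) auto
  ultimately have "emeasure \<nu> {..<0} = 0"
    by simp
  then have nonneg: "AE x in \<nu>. 0 \<le> x"
    by (intro AE_I[where N = "{..<0}"]) auto
  interpret \<nu>: nonneg_distribution \<nu>
    by standard (rule nonneg)
  have int_sum: "integrable ?P (\<lambda>x. \<Sum>i<n. x i)"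
    using M.integrable_id unfolding eq[symmetric] by (subst (asm) integrable_distr_eq[OF sum_m]) auto
  have "integrable ?P (\<lambda>x. x 0)"
  proof (rule Bochner_Integration.integrable_bound[OF int_sum])
    have "0 \<in> {..<n}"
      using \<open>0 < n\<close> by simp
    then show "(\<lambda>x. x 0) \<in> borel_measurable ?P"
      by measurable
    show "AE x in ?P. norm (x 0) \<le> norm (\<Sum>i<n. x i)"
      using \<nu>.AE_PiM_nonneg[of n]
    proof eventually_elim
      case (elim x)
      then have "x 0 \<le> (\<Sum>i<n. x i)"
        using \<open>0 < n\<close> by (intro member_le_sum) auto
      then show ?case
        using elim \<open>0 < n\<close> by simp
    qed
  qed
  then have int: "integrable \<nu> (\<lambda>x. x)"
  proof (rule integral_PiM_component(1)[OF \<nu>, of 0 "{..<n}" "\<lambda>x. x", THEN iffD1, rotated 2])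
    show "0 \<in> {..<n}" using \<open>0 < n\<close> by simp
    show "(\<lambda>x::real. x) \<in> borel_measurable borel" by measurable
  qed
  have int_i: "integrable ?P (\<lambda>x. x i)" if "i < n" for i
  proof (rule integral_PiM_component(1)[OF \<nu>, of i "{..<n}" "\<lambda>x. x", THEN iffD2])
    show "i \<in> {..<n}" using that by simp
    show "(\<lambda>x::real. x) \<in> borel_measurable borel" by measurable
  qed (rule int)
  have "(\<integral>x. x \<partial>M) = (\<integral>x. (\<Sum>i<n. x i) \<partial>?P)"
    unfolding eq[symmetric] by (subst integral_distr[OF sum_m]) auto
  also have "\<dots> = (\<Sum>i<n. \<integral>x. x i \<partial>?P)"
    using int_i by (intro Bochner_Integration.integral_sum) auto
  also have "\<dots> = (\<Sum>i<n. \<integral>x. x \<partial>\<nu>)"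
    by (rule sum.cong[OF refl], rule integral_PiM_component(2)[OF \<nu>, where f = "\<lambda>x. x"]) simp_all
  finally show mean: "n * (\<integral>x. x \<partial>\<nu>) = (\<integral>x. x \<partial>M)"
    by simp
  then have "0 < (\<integral>x. x \<partial>\<nu>)"
    using M.mean_pos \<open>0 < n\<close> by (metis of_nat_0_less_iff zero_less_mult_pos)
  with int show "pos_mean_distribution \<nu>"
    by unfold_locales
qed

text \<open>Size biasing a sum of independent copies biases just one summand. Analytically, the two
  sides come from differentiating \<open>char M\<close> directly and as the power
  \<open>char \<nu> t ^ Suc n\<close>; the factor \<open>Suc n\<close> is absorbed by the ratio of
  the means.\<close>

lemma char_size_law_iid_sum_law:
  assumes M: "pos_mean_distribution M" and \<nu>: "real_distribution \<nu>"
    and eq: "iid_sum_law (Suc n) \<nu> = M"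
  shows "char (size_law M) t = char \<nu> t ^ n * char (size_law \<nu>) t"
proof -
  interpret M: pos_mean_distribution M by fact
  interpret \<nu>: pos_mean_distribution \<nu>
    using iid_sum_law_root(1)[OF M \<nu> eq] by simp
  have mean: "Suc n * (\<integral>x. x \<partial>\<nu>) = (\<integral>x. x \<partial>M)"
    using iid_sum_law_root(2)[OF M \<nu> eq] by simp
  have eq': "char M = (\<lambda>t. char \<nu> t ^ Suc n)"
    using char_iid_sum[OF \<nu>, of "Suc n"] eq by auto
  have "((\<lambda>t. char \<nu> t ^ Suc n) has_vector_derivative
      (\<i> * (\<integral>x. x \<partial>\<nu>) * char (size_law \<nu>) t) * (of_nat (Suc n) * char \<nu> t ^ n)) (at t)"
  proof -
    have "((\<lambda>z. z ^ Suc n) has_field_derivative of_nat (Suc n) * z ^ n) (at z)" for z :: complex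
      by (rule derivative_eq_intros refl)+ (simp del: power_Suc of_nat_Suc)
    from field_vector_diff_chain_at[OF \<nu>.has_vector_derivative_char this] show ?thesis
      by (simp only: o_def)
  qed
  from vector_derivative_unique_at[OF this M.has_vector_derivative_char[of t, unfolded eq']]
  have "\<i> * ((of_nat (Suc n) * complex_of_real (\<integral>x. x \<partial>\<nu>)) * (char \<nu> t ^ n * char (size_law \<nu>) t)) =
      \<i> * ((\<integral>x. x \<partial>M) * char (size_law M) t)"
    by (simp only: mult_ac)
  also have "of_nat (Suc n) * complex_of_real (\<integral>x. x \<partial>\<nu>) = (\<integral>x. x \<partial>M)"
    using mean by (metis of_real_mult of_real_of_nat_eq)
  finally show ?thesis
    using M.mean_pos by simp
qed

text \<open>Times the mean, the tail of the size biased law is the integral of \<open>x\<close> over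
  \<open>{b<..}\<close>. For nonnegative summands \<open>x i > b\<close> forces the whole sum above
  \<open>b\<close>, so the truncated summands add up to at most the truncated sum. Both sides are
  then divided by the same total mean.\<close>

lemma measure_size_law_tail_le:
  assumes M: "pos_mean_distribution M" and \<nu>: "real_distribution \<nu>"
    and eq: "iid_sum_law n \<nu> = M" and "0 < n"
  shows "measure (size_law \<nu>) {b<..} \<le> measure (size_law M) {b<..}"
proof -
  interpret M: pos_mean_distribution M by fact
  interpret \<nu>: pos_mean_distribution \<nu>
    using iid_sum_law_root(1)[OF M \<nu> eq \<open>0 < n\<close>] .
  have mean: "n * (\<integral>x. x \<partial>\<nu>) = (\<integral>x. x \<partial>M)"
    using iid_sum_law_root(2)[OF M \<nu> eq \<open>0 < n\<close>] .
  let ?P = "\<Pi>\<^sub>M i\<in>{..<n}. \<nu>" and ?f = "\<lambda>x. x * indicator {b<..} x :: real"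
  \<comment> \<open>The unnormalised form of the tail, needed for both \<open>\<nu>\<close> and
    \<open>M\<close>.\<close>
  have tail: "(\<integral>x. x \<partial>N) * measure (size_law N) {b<..} = (\<integral>x. ?f x \<partial>N)"
    if "pos_mean_distribution N" for N
  proof -
    interpret N: pos_mean_distribution N by fact
    interpret S: nonneg_distribution "size_law N" by (rule N.nonneg_distribution_size_law)
    have "measure (size_law N) {b<..} = (\<integral>x. indicator {b<..} x \<partial>size_law N)"
      by simp
    also have "\<dots> = (\<integral>x. ?f x \<partial>N) / (\<integral>x. x \<partial>N)"
      by (subst N.integral_size_law) (auto simp: divide_inverse mult.commute)
    finally show ?thesis
      using N.mean_pos by (simp add: field_simps)
  qed
  have int: "integrable ?P (\<lambda>x. ?f (x i))" if "i < n" for i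
  proof (rule integral_PiM_component(1)[OF \<nu>, of i "{..<n}" ?f, THEN iffD2])
    show "integrable \<nu> ?f"
      using integrable_mult_indicator[OF _ \<nu>.integrable_id, of "{b<..}"] by (simp add: mult.commute)
  qed (use that in auto)
  have sum_m: "(\<lambda>x. \<Sum>i<n. x i) \<in> borel_measurable ?P"
    by measurable
  have "n * (\<integral>x. ?f x \<partial>\<nu>) = (\<Sum>i<n. \<integral>x. ?f (x i) \<partial>?P)"
  proof -
    have "(\<integral>x. ?f (x i) \<partial>?P) = (\<integral>x. ?f x \<partial>\<nu>)" if "i < n" for i
      by (rule integral_PiM_component(2)[OF \<nu>, of i "{..<n}" ?f]) (use that in auto)
    then show ?thesis by simp
  qed
  also have "\<dots> = (\<integral>x. (\<Sum>i<n. ?f (x i)) \<partial>?P)"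
    using int by (intro Bochner_Integration.integral_sum[symmetric]) auto
  also have "\<dots> \<le> (\<integral>x. ?f (\<Sum>i<n. x i) \<partial>?P)"
  proof (rule integral_mono_AE)
    show "integrable ?P (\<lambda>x. \<Sum>i<n. ?f (x i))"
      using int by (intro Bochner_Integration.integrable_sum) auto
    have "integrable M ?f"
      using integrable_mult_indicator[OF _ M.integrable_id, of "{b<..}"] by (simp add: mult.commute)
    then show "integrable ?P (\<lambda>x. ?f (\<Sum>i<n. x i))"
      unfolding eq[symmetric] by (subst (asm) integrable_distr_eq[OF sum_m]) auto
    show "AE x in ?P. (\<Sum>i<n. ?f (x i)) \<le> ?f (\<Sum>i<n. x i)"
      using \<nu>.AE_PiM_nonneg[of n]
    proof eventually_elim
      case (elim x)
      have "?f (x i) \<le> x i * indicator {b<..} (\<Sum>i<n. x i)" if "i < n" for i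
      proof -
        have "x i \<le> (\<Sum>i<n. x i)"
          using that elim by (intro member_le_sum) auto
        then show ?thesis
          using elim that by (auto split: split_indicator)
      qed
      then have "(\<Sum>i<n. ?f (x i)) \<le> (\<Sum>i<n. x i * indicator {b<..} (\<Sum>i<n. x i))"
        by (intro sum_mono) auto
      then show ?case
        by (simp add: sum_distrib_right)
    qed
  qed
  also have "\<dots> = (\<integral>x. ?f x \<partial>M)"
    unfolding eq[symmetric] by (subst integral_distr[OF sum_m]) auto
  finally have "n * ((\<integral>x. x \<partial>\<nu>) * measure (size_law \<nu>) {b<..}) \<le>
      (\<integral>x. x \<partial>M) * measure (size_law M) {b<..}"
    by (simp add: tail M \<nu>.pos_mean_distribution_axioms)
  then show ?thesis
    using M.mean_pos by (simp add: mean mult.assoc[symmetric])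
qed

lemma (in real_distribution) ex_tail_less:
  assumes "0 < e"
  shows "\<exists>b. measure M {b<..} < e"
proof -
  have "\<forall>\<^sub>F b in at_top. 1 - e < cdf M b"
    using assms by (intro order_tendstoD[OF cdf_lim_at_top_prob]) simp
  then obtain b where "1 - e < cdf M b"
    by (auto dest: eventually_happens)
  moreover have "measure M {b<..} = 1 - cdf M b"
    using prob_compl[of "{..b}"] by (simp add: cdf_def Compl_eq_Diff_UNIV[symmetric])
  ultimately show ?thesis
    by (intro exI[of _ b]) simp
qed

text \<open>With \<open>R n\<close> a convolution root of order \<open>n + 1\<close>, the biased
  characteristic function is \<open>char (R n) t ^ n\<close> times that of
  \<open>size_law (R n)\<close>. The first factor tends to \<open>char M t\<close>; the second
  converges along a subsequence, since the tails are dominated by those of the single law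
  \<open>size_law M\<close>.\<close>

lemma (in pos_mean_distribution) infinitely_divisible_char_size_law:
  assumes "infinitely_divisible M"
  obtains \<nu> where "nonneg_distribution \<nu>" "\<And>t. char (size_law M) t = char M t * char \<nu> t"
proof -
  have M: "pos_mean_distribution M" ..
  interpret S: nonneg_distribution "size_law M" by (rule nonneg_distribution_size_law)
  have "\<exists>\<nu>. real_distribution \<nu> \<and> iid_sum_law (Suc n) \<nu> = M" for n
    using assms by (auto simp: infinitely_divisible_def real_distribution_def real_distribution_axioms_def
        simp del: sum.lessThan_Suc dest!: spec[of _ "Suc n"])
  then obtain R where R: "\<And>n. real_distribution (R n)" and eq: "\<And>n. iid_sum_law (Suc n) (R n) = M"
    by metis
  interpret R: pos_mean_distribution "R n" for n
    using iid_sum_law_root(1)[OF M R eq] by simp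
  have mean: "Suc n * (\<integral>x. x \<partial>R n) = (\<integral>x. x \<partial>M)" for n
    using iid_sum_law_root(2)[OF M R eq] by simp
  have char_R: "char (R n) t ^ Suc n = char M t" for n t
    using char_iid_sum[OF R, of "Suc n" n t] eq[of n] by simp
  have lim: "(\<lambda>n. char (R n) t ^ n) \<longlonglongrightarrow> char M t" for t
  proof (rule LIM_zero_cancel, rule Lim_null_comparison)
    show "\<forall>\<^sub>F n in sequentially. norm (char (R n) t ^ n - char M t) \<le> \<bar>t\<bar> * (\<integral>x. x \<partial>M) * (1 / Suc n)"
    proof (rule always_eventually, rule allI)
      fix n
      \<comment> \<open>\<open>char M t\<close> is the power \<open>Suc n\<close>, one factor more
        than on the left; the missing factor is within order \<open>1 / Suc n\<close> of 1.\<close>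
      have "char (R n) t ^ n - char M t = - (char (R n) t ^ n * (char (R n) t - 1))"
        by (simp add: char_R[of n, symmetric] algebra_simps)
      then have "norm (char (R n) t ^ n - char M t) = norm (char (R n) t) ^ n * norm (char (R n) t - 1)"
        by (simp only: norm_minus_cancel norm_mult norm_power)
      also have "\<dots> \<le> 1 * (\<bar>t\<bar> * (\<integral>x. x \<partial>R n))"
        by (intro mult_mono R.norm_char_minus_1_le power_le_one R.cmod_char_le_1) auto
      also have "\<dots> = \<bar>t\<bar> * (\<integral>x. x \<partial>M) * (1 / Suc n)"
        by (simp add: mean[of n, symmetric] del: of_nat_Suc)
      finally show "norm (char (R n) t ^ n - char M t) \<le> \<bar>t\<bar> * (\<integral>x. x \<partial>M) * (1 / Suc n)" .
    qed
    have "(\<lambda>n. \<bar>t\<bar> * (\<integral>x. x \<partial>M) * (1 / Suc n)) \<longlonglongrightarrow> \<bar>t\<bar> * (\<integral>x. x \<partial>M) * 0"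
      by (intro tendsto_mult tendsto_const LIMSEQ_Suc[OF lim_1_over_n])
    then show "(\<lambda>n. \<bar>t\<bar> * (\<integral>x. x \<partial>M) * (1 / Suc n)) \<longlonglongrightarrow> 0"
      by simp
  qed
  obtain r \<nu> where r: "strict_mono r" and \<nu>: "nonneg_distribution \<nu>"
    and conv: "\<And>t. (\<lambda>n. char (size_law (R (r n))) t) \<longlonglongrightarrow> char \<nu> t"
  proof (rule nonneg_distribution_char_subseq[of "\<lambda>n. size_law (R n)"])
    show "nonneg_distribution (size_law (R n))" for n
      by (rule R.nonneg_distribution_size_law)
    show "\<exists>b. \<forall>n. measure (size_law (R n)) {b<..} < e" if "0 < e" for e
      using S.ex_tail_less[OF that] measure_size_law_tail_le[OF M R eq] by (meson le_less_trans zero_less_Suc)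
  qed (rule that)
  have "char (size_law M) t = char M t * char \<nu> t" for t
  proof (rule LIMSEQ_unique)
    show "(\<lambda>n. char (R (r n)) t ^ r n * char (size_law (R (r n))) t) \<longlonglongrightarrow> char M t * char \<nu> t"
      using LIMSEQ_subseq_LIMSEQ[OF lim r] by (intro tendsto_mult conv) (simp add: o_def)
    \<comment> \<open>By the factorisation for each root this sequence is constant.\<close>
    show "(\<lambda>n. char (R (r n)) t ^ r n * char (size_law (R (r n))) t) \<longlonglongrightarrow> char (size_law M) t"
      using char_size_law_iid_sum_law[OF M R eq] by (simp flip: char_size_law_iid_sum_law)
  qed
  with \<nu> show ?thesis
    by (rule that)
qed

subsection \<open>Tail densities and independent summands\<close>

text \<open>The integrated tail law, known in renewal theory as the equilibrium distribution of
  \<open>\<nu>\<close>.\<close>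

definition tail_law :: "real measure \<Rightarrow> real measure" where
  "tail_law \<nu> = density lborel
     (\<lambda>x. ennreal (if 0 \<le> x then measure \<nu> {x..} / (\<integral>x. x \<partial>\<nu>) else 0))"

context pos_mean_distribution
begin

text \<open>As the integral of a jointly measurable indicator, the tail is visibly measurable in
  \<open>x\<close> and open to Fubini.\<close>

lemma tail_eq_integral:
  "(if 0 \<le> x then measure M {x..} else 0) = (\<integral>y. (if 0 \<le> x \<and> x \<le> y then 1 else 0) \<partial>M)"
proof -
  have "(\<integral>y. (if x \<le> y then 1 else 0) \<partial>M) = (\<integral>y. indicator {x..} y \<partial>M)"
    by (rule Bochner_Integration.integral_cong) (auto split: split_indicator)
  also have "\<dots> = measure M {x..}"
    by simp
  finally show ?thesis by simp
qed

lemma tail_measurable [measurable]: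
  "(\<lambda>x. if 0 \<le> x then measure M {x..} else 0) \<in> borel_measurable borel"
  unfolding tail_eq_integral by measurable

lemma tail_density_measurable [measurable]:
  "(\<lambda>x. if 0 \<le> x then measure M {x..} / (\<integral>x. x \<partial>M) else 0) \<in> borel_measurable borel"
proof -
  have "(\<lambda>x. (if 0 \<le> x then measure M {x..} else 0) / (\<integral>x. x \<partial>M)) \<in> borel_measurable borel"
    by measurable
  then show ?thesis
    by (rule measurable_cong[THEN iffD1, rotated]) auto
qed

text \<open>Exchange the integrals over the triangle \<open>0 \<le> x \<le> y\<close>: for fixed
  \<open>y\<close> the section in \<open>x\<close> has length \<open>y\<close>.\<close>

lemma nn_integral_triangle:
  "(\<integral>\<^sup>+x. \<integral>\<^sup>+y. (if 0 \<le> x \<and> x \<le> y then 1 else 0) \<partial>M \<partial>lborel) = ennreal (\<integral>x. x \<partial>M)"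
proof -
  interpret P: pair_sigma_finite lborel M ..
  have "(\<integral>\<^sup>+x. \<integral>\<^sup>+y. (if 0 \<le> x \<and> x \<le> y then 1 else 0) \<partial>M \<partial>lborel) =
      (\<integral>\<^sup>+y. \<integral>\<^sup>+x. (if 0 \<le> x \<and> x \<le> y then 1 else 0) \<partial>lborel \<partial>M)"
    by (rule P.Fubini'[symmetric]) measurable
  also have "\<dots> = (\<integral>\<^sup>+y. ennreal y \<partial>M)"
  proof (rule nn_integral_cong_AE)
    show "AE y in M. (\<integral>\<^sup>+x. (if 0 \<le> x \<and> x \<le> y then 1 else 0) \<partial>lborel) = ennreal y"
      using nonneg
    proof eventually_elim
      case (elim y)
      have "(\<integral>\<^sup>+x. (if 0 \<le> x \<and> x \<le> y then 1 else 0) \<partial>lborel) = (\<integral>\<^sup>+x. indicator {0..y} x \<partial>lborel)"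
        by (rule nn_integral_cong) (auto split: split_indicator)
      then show ?case using elim by simp
    qed
  qed
  also have "\<dots> = ennreal (\<integral>x. x \<partial>M)"
    using integrable_id nonneg by (rule nn_integral_eq_integral)
  finally show ?thesis .
qed

text \<open>The area under the tail is the mean, by \<open>nn_integral_triangle\<close>, so the
  normalisation gives total mass 1.\<close>

lemma real_distribution_tail_law: "real_distribution (tail_law M)"
proof -
  have "emeasure (tail_law M) (space (tail_law M)) =
      (\<integral>\<^sup>+x. ennreal (if 0 \<le> x then measure M {x..} / (\<integral>x. x \<partial>M) else 0) \<partial>lborel)"
    by (simp add: tail_law_def emeasure_density)
  also have "\<dots> = (\<integral>\<^sup>+x. ennreal (1 / (\<integral>x. x \<partial>M)) *
      (\<integral>\<^sup>+y. (if 0 \<le> x \<and> x \<le> y then 1 else 0) \<partial>M) \<partial>lborel)"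
  proof (rule nn_integral_cong)
    fix x
    have "(\<integral>\<^sup>+y. (if 0 \<le> x \<and> x \<le> y then 1 else 0) \<partial>M) = (\<integral>\<^sup>+y. (if 0 \<le> x then indicator {x..} y else 0) \<partial>M)"
      by (rule nn_integral_cong) (auto split: split_indicator)
    also have "\<dots> = ennreal (if 0 \<le> x then measure M {x..} else 0)"
      by (simp add: emeasure_eq_measure)
    finally show "ennreal (if 0 \<le> x then measure M {x..} / (\<integral>x. x \<partial>M) else 0) =
        ennreal (1 / (\<integral>x. x \<partial>M)) * (\<integral>\<^sup>+y. (if 0 \<le> x \<and> x \<le> y then 1 else 0) \<partial>M)"
      using mean_pos by (simp add: ennreal_mult[symmetric])
  qed
  also have "\<dots> = ennreal (1 / (\<integral>x. x \<partial>M)) * ennreal (\<integral>x. x \<partial>M)"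
    by (subst nn_integral_cmult) (auto simp: nn_integral_triangle)
  also have "\<dots> = 1"
    using mean_pos by (simp add: ennreal_mult[symmetric])
  finally interpret T: prob_space "tail_law M"
    by (rule prob_spaceI)
  show ?thesis
    by standard (simp add: tail_law_def)
qed

text \<open>Fubini for \<open>\<i> * t * iexp (t * x)\<close> on the triangle
  \<open>0 \<le> x \<le> y\<close>. Integrating over \<open>x\<close> first gives
  \<open>iexp (t * y) - 1\<close> by the fundamental theorem of calculus; integrating over
  \<open>y\<close> first gives the tail as a weight. In this product form the identity covers
  \<open>t = 0\<close>.\<close>

lemma char_tail_law:
  "of_real (\<integral>x. x \<partial>M) * (\<i> * of_real t) * char (tail_law M) t = char M t - 1"
proof -
  interpret P: pair_sigma_finite lborel M ..
  define k where "k x y = (if 0 \<le> x \<and> x \<le> y then \<i> * of_real t * iexp (t * x) else 0)" for x y :: real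
  have [measurable]: "case_prod k \<in> borel_measurable (lborel \<Otimes>\<^sub>M M)"
    unfolding k_def[abs_def] by measurable
  \<comment> \<open>The integrand has norm \<open>\<bar>t\<bar>\<close> on the triangle, whose mass
    is the finite mean.\<close>
  have "integrable (lborel \<Otimes>\<^sub>M M) (case_prod k)"
  proof (rule integrableI_bounded)
    have "(\<integral>\<^sup>+z. ennreal (norm (case_prod k z)) \<partial>(lborel \<Otimes>\<^sub>M M)) =
        (\<integral>\<^sup>+x. \<integral>\<^sup>+y. ennreal (norm (k x y)) \<partial>M \<partial>lborel)"
      by (subst nn_integral_fst[symmetric]) auto
    also have "\<dots> = (\<integral>\<^sup>+x. \<integral>\<^sup>+y. ennreal \<bar>t\<bar> * (if 0 \<le> x \<and> x \<le> y then 1 else 0) \<partial>M \<partial>lborel)"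
      by (intro nn_integral_cong) (auto simp: k_def norm_mult)
    also have "\<dots> = ennreal \<bar>t\<bar> * ennreal (\<integral>x. x \<partial>M)"
      by (simp add: nn_integral_cmult nn_integral_triangle)
    also have "\<dots> < \<infinity>"
      by (simp add: ennreal_mult_less_top)
    finally show "(\<integral>\<^sup>+z. ennreal (norm (case_prod k z)) \<partial>(lborel \<Otimes>\<^sub>M M)) < \<infinity>" .
  qed simp
  from P.Fubini_integral[OF this]
  have fub: "(\<integral>y. \<integral>x. k x y \<partial>lborel \<partial>M) = (\<integral>x. \<integral>y. k x y \<partial>M \<partial>lborel)" .
  have "(\<integral>y. \<integral>x. k x y \<partial>lborel \<partial>M) = (\<integral>y. iexp (t * y) - 1 \<partial>M)"
  proof (rule integral_cong_AE)
    show "AE y in M. (\<integral>x. k x y \<partial>lborel) = iexp (t * y) - 1"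
      using nonneg
    proof eventually_elim
      case (elim y)
      have "(\<integral>x. k x y \<partial>lborel) = (\<integral>x. indicator {0..y} x *\<^sub>R (\<i> * of_real t * iexp (t * x)) \<partial>lborel)"
        by (rule Bochner_Integration.integral_cong) (auto simp: k_def split: split_indicator)
      also have "\<dots> = iexp (t * y) - iexp (t * 0)"
      proof (rule integral_FTC_Icc[OF elim])
        fix x
        have "((\<lambda>s. t * s) has_vector_derivative t) (at x)"
          by (auto intro!: derivative_eq_intros)
        from vector_diff_chain_at[OF this has_vector_derivative_iexp]
        have "((\<lambda>s. iexp (t * s)) has_vector_derivative \<i> * of_real t * iexp (t * x)) (at x)"
          by (simp only: o_def scaleR_conv_of_real mult.left_commute mult.assoc)
        then show "((\<lambda>s. iexp (t * s)) has_vector_derivative \<i> * of_real t * iexp (t * x)) (at x within {0..y})"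
          by (rule has_vector_derivative_at_within)
      qed (intro continuous_intros)
      finally show ?case by simp
    qed
  qed measurable
  also have "\<dots> = char M t - 1"
    using integrable_char[of t] prob_space by (simp add: char_def)
  finally have lhs: "(\<integral>y. \<integral>x. k x y \<partial>lborel \<partial>M) = char M t - 1" .
  have "(\<integral>y. k x y \<partial>M) =
      (if 0 \<le> x then measure M {x..} else 0) *\<^sub>R (\<i> * of_real t * iexp (t * x))" for x
  proof -
    have "(\<integral>y. k x y \<partial>M) = (\<integral>y. (if 0 \<le> x \<and> x \<le> y then 1 else 0::real) *\<^sub>R (\<i> * of_real t * iexp (t * x)) \<partial>M)"
      by (rule Bochner_Integration.integral_cong) (auto simp: k_def)
    also have "\<dots> = (\<integral>y. (if 0 \<le> x \<and> x \<le> y then 1 else 0::real) \<partial>M) *\<^sub>R (\<i> * of_real t * iexp (t * x))"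
      by (rule integral_scaleR_left) (auto intro!: integrable_const_bound[where B = 1])
    finally show ?thesis
      by (simp only: tail_eq_integral)
  qed
  then have "(\<integral>x. \<integral>y. k x y \<partial>M \<partial>lborel) = (\<integral>x. (of_real (\<integral>x. x \<partial>M) * (\<i> * of_real t)) *
      ((if 0 \<le> x then measure M {x..} / (\<integral>x. x \<partial>M) else 0) *\<^sub>R iexp (t * x)) \<partial>lborel)"
    using mean_pos by (intro Bochner_Integration.integral_cong) (auto simp: scaleR_conv_of_real)
  also have "\<dots> = of_real (\<integral>x. x \<partial>M) * (\<i> * of_real t) *
      (\<integral>x. (if 0 \<le> x then measure M {x..} / (\<integral>x. x \<partial>M) else 0) *\<^sub>R iexp (t * x) \<partial>lborel)"
    by (rule integral_mult_right_zero)
  also have "(\<integral>x. (if 0 \<le> x then measure M {x..} / (\<integral>x. x \<partial>M) else 0) *\<^sub>R iexp (t * x) \<partial>lborel) = char (tail_law M) t"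
    unfolding tail_law_def char_def using mean_pos by (intro integral_density[symmetric]) auto
  finally show ?thesis
    using fub lhs by simp
qed

end

text \<open>Turns \<open>tail_density\<close> into an equality of laws, which can be settled by
  characteristic functions.\<close>

lemma tail_density_iff:
  assumes "X' \<in> borel_measurable Q" "prob_space P" "X'' \<in> borel_measurable P"
    and "pos_mean_distribution (distr Q borel X')" "prob_space Q"
  shows "tail_density P X'' Q X' \<longleftrightarrow> distr P borel X'' = tail_law (distr Q borel X')"
proof -
  interpret \<nu>: pos_mean_distribution "distr Q borel X'" by fact
  have eq: "(if 0 \<le> x then measure Q {\<omega> \<in> space Q. x \<le> X' \<omega>} / (\<integral>\<omega>. X' \<omega> \<partial>Q) else 0) =
      (if 0 \<le> x then measure (distr Q borel X') {x..} / (\<integral>x. x \<partial>distr Q borel X') else 0)" for x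
  proof -
    have "X' -` {x..} \<inter> space Q = {\<omega> \<in> space Q. x \<le> X' \<omega>}" by auto
    then show ?thesis
      using assms(1) by (simp add: measure_distr integral_distr)
  qed
  have "distr P lborel X'' = distr P borel X''"
    by (rule distr_cong) auto
  moreover have "AE \<omega> in Q. 0 \<le> X' \<omega>"
    using \<nu>.nonneg assms(1) by (subst (asm) AE_distr_iff) auto
  moreover have "integrable Q X'"
    using \<nu>.integrable_id assms(1) by (subst (asm) integrable_distr_eq) auto
  ultimately show ?thesis
    unfolding tail_density_def distributed_def eq
    using assms \<nu>.tail_density_measurable by (auto simp: tail_law_def)
qed

section \<open>Independent decompositions as products of characteristic functions\<close>

lemma indep_decompD:
  assumes "indep_decomp M X N W P Y Z"
  shows "prob_space P" "Z \<in> borel_measurable P"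
    and "char (distr N borel W) t = char (distr M borel X) t * char (distr P borel Z) t"
proof -
  from assms interpret prob_space P by (simp add: indep_decomp_def)
  show "prob_space P" by (rule prob_space_axioms)
  from assms have ind: "indep_var borel Y borel Z" by (simp add: indep_decomp_def)
  then show "Z \<in> borel_measurable P" by (rule indep_var_rv2)
  show "char (distr N borel W) t = char (distr M borel X) t * char (distr P borel Z) t"
    using char_distr_add[OF ind] assms by (simp add: indep_decomp_def)
qed

text \<open>The coordinates of the product measure are independent with the two prescribed laws.
  Their sum has characteristic function \<open>char (distr M borel X) t * char \<nu> t\<close>, so
  Levy's uniqueness theorem identifies its law.\<close>

lemma indep_decomp_pair:
  assumes \<mu>: "real_distribution (distr M borel X)" and "real_distribution (distr N borel W)"
    and \<nu>: "real_distribution \<nu>"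
    and eq: "\<And>t. char (distr N borel W) t = char (distr M borel X) t * char \<nu> t"
  shows "indep_decomp M X N W (distr M borel X \<Otimes>\<^sub>M \<nu>) fst snd"
    and "distr (distr M borel X \<Otimes>\<^sub>M \<nu>) borel snd = \<nu>"
proof -
  define \<mu>' where "\<mu>' = distr M borel X"
  interpret \<mu>: real_distribution \<mu>' using \<mu> by (simp add: \<mu>'_def)
  interpret \<nu>: real_distribution \<nu> by fact
  interpret P: pair_prob_space \<mu>' \<nu> ..
  have s: "sets (\<mu>' \<Otimes>\<^sub>M \<nu>) = sets (borel \<Otimes>\<^sub>M borel)"
    by (rule sets_pair_measure_cong) auto
  have fst: "distr (\<mu>' \<Otimes>\<^sub>M \<nu>) borel fst = \<mu>'"
    using \<nu>.distr_pair_fst[of \<mu>'] by (metis distr_cong \<mu>.events_eq_borel)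
  have snd: "distr (\<mu>' \<Otimes>\<^sub>M \<nu>) borel snd = \<nu>"
  proof -
    have "distr (\<mu>' \<Otimes>\<^sub>M \<nu>) borel snd = distr (\<nu> \<Otimes>\<^sub>M \<mu>') borel fst"
      by (subst P.distr_pair_swap) (auto simp: distr_distr o_def case_prod_unfold)
    then show ?thesis
      using \<mu>.distr_pair_fst[of \<nu>] by (metis distr_cong \<nu>.events_eq_borel)
  qed
  then show "distr (distr M borel X \<Otimes>\<^sub>M \<nu>) borel snd = \<nu>"
    by (simp add: \<mu>'_def)
  have ind: "P.P.indep_var borel fst borel snd"
  proof (subst P.P.indep_var_distribution_eq, intro conjI)
    have "distr (\<mu>' \<Otimes>\<^sub>M \<nu>) (borel \<Otimes>\<^sub>M borel) (\<lambda>x. (fst x, snd x)) = distr (\<mu>' \<Otimes>\<^sub>M \<nu>) (\<mu>' \<Otimes>\<^sub>M \<nu>) (\<lambda>x. x)"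
      by (rule distr_cong) (auto simp: s)
    then show "distr (\<mu>' \<Otimes>\<^sub>M \<nu>) borel fst \<Otimes>\<^sub>M distr (\<mu>' \<Otimes>\<^sub>M \<nu>) borel snd =
        distr (\<mu>' \<Otimes>\<^sub>M \<nu>) (borel \<Otimes>\<^sub>M borel) (\<lambda>x. (fst x, snd x))"
      by (simp add: fst snd)
  qed measurable
  have "distr N borel W = distr (\<mu>' \<Otimes>\<^sub>M \<nu>) borel (\<lambda>\<omega>. fst \<omega> + snd \<omega>)"
  proof (rule Levy_uniqueness)
    show "real_distribution (distr (\<mu>' \<Otimes>\<^sub>M \<nu>) borel (\<lambda>\<omega>. fst \<omega> + snd \<omega>))"
      by (rule P.P.real_distribution_distr) measurable
    show "char (distr N borel W) = char (distr (\<mu>' \<Otimes>\<^sub>M \<nu>) borel (\<lambda>\<omega>. fst \<omega> + snd \<omega>))"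
      by (rule ext) (simp add: P.P.char_distr_add[OF ind] eq fst snd \<mu>'_def[symmetric])
  qed fact
  then show "indep_decomp M X N W (distr M borel X \<Otimes>\<^sub>M \<nu>) fst snd"
    unfolding indep_decomp_def \<mu>'_def[symmetric]
    using P.P.prob_space_axioms ind fst by simp
qed

text \<open>Realise \<open>\<sigma>\<close> as the law of \<open>fst + snd\<close> under the product
  of \<open>\<mu>\<close> and \<open>\<nu>\<close>; then \<open>snd\<close> is integrable as the
  difference of two integrable functions, and the means add.\<close>

lemma char_factor_mean:
  assumes \<mu>: "real_distribution \<mu>" and \<sigma>: "real_distribution \<sigma>" and \<nu>: "real_distribution \<nu>"
    and int: "integrable \<mu> (\<lambda>x. x)" "integrable \<sigma> (\<lambda>x. x)"
    and eq: "\<And>t. char \<sigma> t = char \<mu> t * char \<nu> t"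
  shows "integrable \<nu> (\<lambda>x. x)" "(\<integral>x. x \<partial>\<sigma>) = (\<integral>x. x \<partial>\<mu>) + (\<integral>x. x \<partial>\<nu>)"
proof -
  interpret \<mu>: real_distribution \<mu> by fact
  interpret \<nu>: real_distribution \<nu> by fact
  interpret \<sigma>: real_distribution \<sigma> by fact
  let ?P = "\<mu> \<Otimes>\<^sub>M \<nu>"
  \<comment> \<open>With identity maps as random variables, \<open>indep_decomp_pair\<close> speaks
    about the laws themselves.\<close>
  have id: "distr \<mu> borel (\<lambda>x. x) = \<mu>" "distr \<sigma> borel (\<lambda>x. x) = \<sigma>"
    by (simp_all add: distr_id2)
  have dec: "indep_decomp \<mu> (\<lambda>x. x) \<sigma> (\<lambda>x. x) ?P fst snd" and snd: "distr ?P borel snd = \<nu>"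
    using indep_decomp_pair[of \<mu> "\<lambda>x. x" \<sigma> "\<lambda>x. x" \<nu>] \<mu> \<sigma> \<nu> eq by (simp_all add: id)
  then have fst: "distr ?P borel fst = \<mu>" and sum: "distr ?P borel (\<lambda>\<omega>. fst \<omega> + snd \<omega>) = \<sigma>"
    by (simp_all add: indep_decomp_def id)
  have m: "fst \<in> borel_measurable ?P" "snd \<in> borel_measurable ?P" "(\<lambda>\<omega>. fst \<omega> + snd \<omega>) \<in> borel_measurable ?P"
    by measurable
  note int_eq = integrable_distr_eq[where f = "\<lambda>x::real. x", OF _ measurable_ident_sets[OF refl]]
  note integral_eq = integral_distr[where f = "\<lambda>x::real. x", OF _ measurable_ident_sets[OF refl]]
  have i1: "integrable ?P fst"
    using int(1) int_eq[OF m(1)] by (simp only: fst)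
  have i2: "integrable ?P (\<lambda>\<omega>. fst \<omega> + snd \<omega>)"
    using int(2) int_eq[OF m(3)] by (simp only: sum)
  have i3: "integrable ?P snd"
    using Bochner_Integration.integrable_diff[OF i2 i1] by simp
  then show "integrable \<nu> (\<lambda>x. x)"
    using int_eq[OF m(2)] by (simp only: snd)
  have "(\<integral>x. x \<partial>\<sigma>) = (\<integral>\<omega>. fst \<omega> + snd \<omega> \<partial>?P)"
    using integral_eq[OF m(3)] by (simp only: sum)
  also have "\<dots> = (\<integral>\<omega>. fst \<omega> \<partial>?P) + (\<integral>\<omega>. snd \<omega> \<partial>?P)"
    using i1 i3 by (rule Bochner_Integration.integral_add)
  also have "(\<integral>\<omega>. fst \<omega> \<partial>?P) = (\<integral>x. x \<partial>\<mu>)"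
    using integral_eq[OF m(1)] by (simp only: fst)
  also have "(\<integral>\<omega>. snd \<omega> \<partial>?P) = (\<integral>x. x \<partial>\<nu>)"
    using integral_eq[OF m(2)] by (simp only: snd)
  finally show "(\<integral>x. x \<partial>\<sigma>) = (\<integral>x. x \<partial>\<mu>) + (\<integral>x. x \<partial>\<nu>)" .
qed

subsection \<open>Biased laws and infinite divisibility\<close>

context pos_mean_distribution
begin

text \<open>The exponential solution has coefficient \<open>c\<close> times the mean, which is
  positive, and drift \<open>1 - c\<close> times the mean, whose sign is arbitrary.\<close>

lemma infinitely_divisible_if_char_size_law:
  assumes \<nu>: "nonneg_distribution \<nu>" and "0 < c"
    and eq: "\<And>t. char (size_law M) t = char M t * (1 + of_real c * (char \<nu> t - 1))"
  shows "infinitely_divisible M"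
proof -
  have M: "real_distribution M" ..
  interpret \<nu>: nonneg_distribution \<nu> by fact
  have "real_distribution \<nu>" ..
  from char_eq_exp_levy_exponent[OF this eq]
  have "char M t = exp (of_real ((\<integral>x. x \<partial>M) * c) * levy_exponent \<nu> t +
      \<i> * of_real ((\<integral>x. x \<partial>M) * (1 - c) * t))" for t
    by (simp add: algebra_simps)
  then show ?thesis
    by (rule infinitely_divisible_char_exp[OF M \<nu>, rotated]) (use mean_pos \<open>0 < c\<close> in simp)
qed

lemma infinitely_divisible_iff_char_size_law:
  "infinitely_divisible M \<longleftrightarrow>
    (\<exists>\<nu>. nonneg_distribution \<nu> \<and> (\<forall>t. char (size_law M) t = char M t * char \<nu> t))"
proof
  assume "infinitely_divisible M"
  then show "\<exists>\<nu>. nonneg_distribution \<nu> \<and> (\<forall>t. char (size_law M) t = char M t * char \<nu> t)"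
    by (rule infinitely_divisible_char_size_law) blast
next
  assume "\<exists>\<nu>. nonneg_distribution \<nu> \<and> (\<forall>t. char (size_law M) t = char M t * char \<nu> t)"
  \<comment> \<open>For \<open>c = 1\<close> the factor \<open>1 + c * (char \<nu> t - 1)\<close> is
    just \<open>char \<nu> t\<close>.\<close>
  then show "infinitely_divisible M"
    using infinitely_divisible_if_char_size_law[of _ 1] by auto
qed

text \<open>The characteristic function is an exponential, by the size biased factorisation.\<close>

lemma infinitely_divisible_char_nonzero:
  assumes "infinitely_divisible M"
  shows "char M t \<noteq> 0"
proof -
  obtain \<nu> where "nonneg_distribution \<nu>" and eq: "\<And>t. char (size_law M) t = char M t * char \<nu> t"
    using infinitely_divisible_char_size_law[OF assms] by blast
  then interpret \<nu>: nonneg_distribution \<nu> by simp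
  have "real_distribution \<nu>" ..
  from char_eq_exp_levy_exponent[OF this, of 1 t] eq show ?thesis
    by simp
qed

text \<open>Source of all uniqueness claims: \<open>char M\<close> vanishes nowhere and can be
  cancelled.\<close>

lemma distr_eq_if_char_mult_eq:
  assumes "infinitely_divisible M" "prob_space P" "Z \<in> borel_measurable P" "real_distribution \<nu>"
    and eq: "\<And>t. char M t * char (distr P borel Z) t = char M t * char \<nu> t"
  shows "distr P borel Z = \<nu>"
  using eq infinitely_divisible_char_nonzero[OF assms(1)]
  by (intro Levy_uniqueness prob_space.real_distribution_distr assms ext) simp

end

section \<open>From biased random variables to their laws\<close>

lemma (in prob_space) pos_mean_distribution_distr:
  assumes X: "X \<in> borel_measurable M" and nonneg: "AE \<omega> in M. 0 \<le> X \<omega>"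
    and int: "integrable M X" and pos: "0 < (\<integral>\<omega>. X \<omega> \<partial>M)"
  shows "pos_mean_distribution (distr M borel X)"
proof -
  have "integrable (distr M borel X) (\<lambda>x. x)"
    using int by (simp add: integrable_distr_eq[OF X])
  moreover have "0 < (\<integral>x. x \<partial>distr M borel X)"
    using pos by (simp add: integral_distr[OF X])
  ultimately show ?thesis
    using nonneg_distribution_distr[OF X nonneg]
    by (simp add: pos_mean_distribution_def pos_mean_distribution_axioms_def)
qed

text \<open>Indicators are admissible test functions, since multiplying \<open>X\<close> by one
  keeps it integrable, and they determine the law.\<close>

lemma size_biased_distr:
  assumes X: "X \<in> borel_measurable M" and int: "integrable M X"
    and pm: "pos_mean_distribution (distr M borel X)"
    and sb: "size_biased M X N W"
  shows "distr N borel W = size_law (distr M borel X)"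
proof -
  interpret \<mu>: pos_mean_distribution "distr M borel X" by fact
  interpret \<sigma>: nonneg_distribution "size_law (distr M borel X)"
    by (rule \<mu>.nonneg_distribution_size_law)
  interpret N: prob_space N
    using sb by (simp add: size_biased_def)
  have W: "W \<in> borel_measurable N"
    using sb by (simp add: size_biased_def)
  interpret D: real_distribution "distr N borel W"
    using W by (rule N.real_distribution_distr)
  have mean: "(\<integral>x. x \<partial>distr M borel X) = (\<integral>\<omega>. X \<omega> \<partial>M)"
    by (simp add: integral_distr[OF X])
  have "measure (distr N borel W) A = measure (size_law (distr M borel X)) A" if A: "A \<in> sets borel" for A
  proof -
    let ?f = "indicator A :: real \<Rightarrow> real"
    have f: "?f \<in> borel_measurable borel"
      using A by simp
    have "integrable M (\<lambda>\<omega>. X \<omega> * ?f (X \<omega>))"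
      using int by (rule Bochner_Integration.integrable_bound) (use X A in \<open>auto split: split_indicator\<close>)
    then have "(\<integral>\<omega>. X \<omega> * ?f (X \<omega>) \<partial>M) = (\<integral>\<omega>. X \<omega> \<partial>M) * (\<integral>\<omega>. ?f (W \<omega>) \<partial>N)"
      using sb f by (simp add: size_biased_def)
    moreover have "(\<integral>\<omega>. X \<omega> * ?f (X \<omega>) \<partial>M) = (\<integral>x. x * ?f x \<partial>distr M borel X)"
      using f by (subst integral_distr[OF X]) auto
    moreover have "(\<integral>\<omega>. ?f (W \<omega>) \<partial>N) = measure (distr N borel W) A"
      using integral_distr[OF W f] A by simp
    moreover have "measure (size_law (distr M borel X)) A =
        (\<integral>x. x * ?f x \<partial>distr M borel X) / (\<integral>x. x \<partial>distr M borel X)"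
      using \<mu>.integral_size_law[OF f] A by (simp add: divide_inverse mult.commute)
    ultimately show ?thesis
      using \<mu>.mean_pos by (simp add: mean)
  qed
  then show ?thesis
    by (intro measure_eqI) (simp_all add: D.emeasure_eq_measure \<sigma>.emeasure_eq_measure)
qed

text \<open>Testing with \<open>sin (t * x)\<close> and \<open>cos (t * x)\<close> gives the
  integral of \<open>(X - m) * iexp (t * X)\<close>. The part with \<open>X\<close> is
  \<open>m\<close> times the size biased characteristic function; the part with \<open>m\<close> is
  \<open>m\<close> times that of \<open>X\<close>.\<close>

lemma zero_biased_char:
  assumes M: "prob_space M" and X: "X \<in> borel_measurable M" and int: "integrable M X"
    and pm: "pos_mean_distribution (distr M borel X)"
    and zb: "zero_biased M X N W"
  shows "of_real (prob_space.variance M X) * (\<i> * of_real t) * char (distr N borel W) t =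
    of_real (\<integral>\<omega>. X \<omega> \<partial>M) * (char (size_law (distr M borel X)) t - char (distr M borel X) t)"
proof -
  interpret M: prob_space M by fact
  interpret \<mu>: pos_mean_distribution "distr M borel X" by fact
  interpret N: prob_space N
    using zb by (simp add: zero_biased_def)
  have W[measurable]: "W \<in> borel_measurable N"
    using zb by (simp add: zero_biased_def)
  note X[measurable]
  define m where "m = (\<integral>\<omega>. X \<omega> \<partial>M)"
  define v where "v = M.variance X"
  have mean: "(\<integral>x. x \<partial>distr M borel X) = m"
    by (simp add: integral_distr[OF X] m_def)
  \<comment> \<open>A bounded \<open>f\<close> with bounded derivative meets both integrability
    conditions of \<open>zero_biased\<close>.\<close>
  have zbD: "(\<integral>\<omega>. (X \<omega> - m) * f (X \<omega>) \<partial>M) = v * (\<integral>\<omega>. f' (W \<omega>) \<partial>N)"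
    if "\<And>x. (f has_real_derivative f' x) (at x)"
      "f \<in> borel_measurable borel" "\<And>x. \<bar>f x\<bar> \<le> 1"
      "f' \<in> borel_measurable borel" "\<And>x. \<bar>f' x\<bar> \<le> B" for f f' B
  proof -
    note [measurable] = that(2,4)
    have "integrable M (\<lambda>\<omega>. X \<omega> * f (X \<omega>))"
      using int
    proof (rule Bochner_Integration.integrable_bound)
      show "AE \<omega> in M. norm (X \<omega> * f (X \<omega>)) \<le> norm (X \<omega>)"
        using that(3) by (intro AE_I2) (simp add: abs_mult mult_left_le)
    qed measurable
    moreover have "integrable N (\<lambda>\<omega>. f' (W \<omega>))"
      using that(5) by (intro N.integrable_const_bound[where B = B]) auto
    ultimately show ?thesis
      using zb that(1) unfolding zero_biased_def m_def v_def by blast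
  qed
  have sin: "(\<integral>\<omega>. (X \<omega> - m) * sin (t * X \<omega>) \<partial>M) = v * (\<integral>\<omega>. t * cos (t * W \<omega>) \<partial>N)"
    by (rule zbD[of "\<lambda>x. sin (t * x)" "\<lambda>x. t * cos (t * x)" "\<bar>t\<bar>"])
       (auto intro!: derivative_eq_intros simp: abs_mult mult_left_le)
  have cos: "(\<integral>\<omega>. (X \<omega> - m) * cos (t * X \<omega>) \<partial>M) = v * (\<integral>\<omega>. - t * sin (t * W \<omega>) \<partial>N)"
    by (rule zbD[of "\<lambda>x. cos (t * x)" "\<lambda>x. - t * sin (t * x)" "\<bar>t\<bar>"])
       (auto intro!: derivative_eq_intros simp: abs_mult mult_left_le)
  have intX: "integrable M (\<lambda>\<omega>. (X \<omega> - m) * g (t * X \<omega>))"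
    if [measurable]: "g \<in> borel_measurable borel" and "\<And>x. \<bar>g x\<bar> \<le> 1" for g :: "real \<Rightarrow> real"
  proof (rule Bochner_Integration.integrable_bound)
    show "integrable M (\<lambda>\<omega>. X \<omega> - m)"
      using int by simp
    show "AE \<omega> in M. norm ((X \<omega> - m) * g (t * X \<omega>)) \<le> norm (X \<omega> - m)"
      using that(2) by (intro AE_I2) (simp add: abs_mult mult_left_le)
  qed measurable
  have intW: "integrable N (\<lambda>\<omega>. g (t * W \<omega>))"
    if [measurable]: "g \<in> borel_measurable borel" and "\<And>x. \<bar>g x\<bar> \<le> 1" for g :: "real \<Rightarrow> real"
    using that(2) by (intro N.integrable_const_bound[where B = 1]) auto
  have iexp_eq: "iexp y = of_real (cos y) + \<i> * of_real (sin y)" for y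
    by (simp add: complex_eq_iff Re_exp Im_exp)
  have "char (distr N borel W) t = (\<integral>\<omega>. iexp (t * W \<omega>) \<partial>N)"
    unfolding char_def by (subst integral_distr) auto
  also have "\<dots> = (\<integral>\<omega>. of_real (cos (t * W \<omega>)) + \<i> * of_real (sin (t * W \<omega>)) \<partial>N)"
    by (simp only: iexp_eq)
  also have "\<dots> = of_real (\<integral>\<omega>. cos (t * W \<omega>) \<partial>N) + \<i> * of_real (\<integral>\<omega>. sin (t * W \<omega>) \<partial>N)"
    using intW[of cos] intW[of sin] by (subst Bochner_Integration.integral_add) auto
  finally have lhs: "char (distr N borel W) t =
      of_real (\<integral>\<omega>. cos (t * W \<omega>) \<partial>N) + \<i> * of_real (\<integral>\<omega>. sin (t * W \<omega>) \<partial>N)" .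
  have "(\<integral>\<omega>. of_real (X \<omega> - m) * iexp (t * X \<omega>) \<partial>M) =
      (\<integral>\<omega>. of_real ((X \<omega> - m) * cos (t * X \<omega>)) + \<i> * of_real ((X \<omega> - m) * sin (t * X \<omega>)) \<partial>M)"
    by (simp only: iexp_eq) (simp only: of_real_mult distrib_left mult.left_commute[of _ \<i>])
  also have "\<dots> = of_real (\<integral>\<omega>. (X \<omega> - m) * cos (t * X \<omega>) \<partial>M) +
      \<i> * of_real (\<integral>\<omega>. (X \<omega> - m) * sin (t * X \<omega>) \<partial>M)"
    using intX[of cos] intX[of sin]
    by (subst Bochner_Integration.integral_add) (auto simp del: of_real_mult of_real_diff)
  also have "\<dots> = of_real v * (\<i> * of_real t) * char (distr N borel W) t"
    unfolding sin cos lhs by (simp add: algebra_simps)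
  finally have "of_real v * (\<i> * of_real t) * char (distr N borel W) t =
      (\<integral>\<omega>. of_real (X \<omega> - m) * iexp (t * X \<omega>) \<partial>M)" ..
  also have "\<dots> = (\<integral>x. of_real (x - m) * iexp (t * x) \<partial>distr M borel X)"
    by (subst integral_distr) auto
  also have "\<dots> = (\<integral>x. of_real x * iexp (t * x) - of_real m * iexp (t * x) \<partial>distr M borel X)"
    by (simp only: of_real_diff left_diff_distrib)
  also have "\<dots> = (\<integral>x. of_real x * iexp (t * x) \<partial>distr M borel X) -
      (\<integral>x. of_real m * iexp (t * x) \<partial>distr M borel X)"
  proof (rule Bochner_Integration.integral_diff)
    show "integrable (distr M borel X) (\<lambda>x. of_real x * iexp (t * x))"
      using \<mu>.integrable_id by (rule Bochner_Integration.integrable_bound) (auto simp: norm_mult)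
    show "integrable (distr M borel X) (\<lambda>x. of_real m * iexp (t * x))"
      by (intro integrable_mult_right \<mu>.integrable_char)
  qed
  also have "(\<integral>x. of_real m * iexp (t * x) \<partial>distr M borel X) = of_real m * char (distr M borel X) t"
    unfolding char_def by (rule integral_mult_right_zero)
  also have "(\<integral>x. of_real x * iexp (t * x) \<partial>distr M borel X) = of_real m * char (size_law (distr M borel X)) t"
    unfolding mean[symmetric] by (rule \<mu>.mean_mult_char_size_law[symmetric])
  finally show ?thesis
    by (simp add: v_def m_def right_diff_distrib)
qed

text \<open>Only the positivity of the mean of \<open>X'\<close> has to be argued: with mean 0 the
  stated density would vanish and \<open>P\<close> would have mass 0.\<close>

lemma tail_densityD:
  assumes td: "tail_density P X'' Q X'"
  shows "pos_mean_distribution (distr Q borel X')"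
    and "distr P borel X'' = tail_law (distr Q borel X')"
proof -
  interpret P: prob_space P using td by (simp add: tail_density_def)
  interpret Q: prob_space Q using td by (simp add: tail_density_def)
  have X': "X' \<in> borel_measurable Q" "AE \<omega> in Q. 0 \<le> X' \<omega>" "integrable Q X'"
    using td by (simp_all add: tail_density_def)
  have X'': "X'' \<in> borel_measurable P"
    using td by (auto simp: tail_density_def distributed_def)
  have "(\<integral>\<omega>. X' \<omega> \<partial>Q) \<noteq> 0"
  proof
    \<comment> \<open>Division by 0 yields 0, so the density collapses to the zero function.\<close>
    assume 0: "(\<integral>\<omega>. X' \<omega> \<partial>Q) = 0"
    have "emeasure (distr P lborel X'') UNIV = emeasure (density lborel (\<lambda>_::real. 0)) UNIV"
      using td unfolding tail_density_def distributed_def 0 by (simp cong: if_cong)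
    then have "emeasure P (space P) = 0"
      using X'' by (simp add: emeasure_distr emeasure_density)
    then show False
      by (simp add: P.emeasure_space_1)
  qed
  moreover have "0 \<le> (\<integral>\<omega>. X' \<omega> \<partial>Q)"
    using X'(2) by (rule integral_nonneg_AE)
  ultimately show pm: "pos_mean_distribution (distr Q borel X')"
    by (intro Q.pos_mean_distribution_distr X') simp
  show "distr P borel X'' = tail_law (distr Q borel X')"
    using tail_density_iff[OF X'(1) P.prob_space_axioms X'' pm Q.prob_space_axioms] td by simp
qed

theorem lemma4p2:
  fixes M :: "'a measure" and X :: "'a \<Rightarrow> real"
    and Ms :: "'b measure" and Xs :: "'b \<Rightarrow> real"
  assumes "prob_space M"
    and "X \<in> borel_measurable M"
    and nonneg: "AE \<omega> in M. 0 \<le> X \<omega>"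
    and finite_mean: "integrable M X"
    and var_pos: "0 < (\<integral>\<^sup>+\<omega>. ennreal ((X \<omega> - (\<integral>\<omega>. X \<omega> \<partial>M))\<^sup>2) \<partial>M)"
    and Xs: "size_biased M X Ms Xs"
  shows
    "(infinitely_divisible (distr M borel X) \<longleftrightarrow>
       (\<exists>(P :: (real \<times> real) measure) Y X'.
          indep_decomp M X Ms Xs P Y X' \<and> (AE \<omega> in P. 0 \<le> X' \<omega>)))
     \<and>
     (infinitely_divisible (distr M borel X) \<longrightarrow>
       (\<forall>(P :: 'p measure) Y X' (Q :: 'q measure) Z W'.
          indep_decomp M X Ms Xs P Y X' \<longrightarrow> indep_decomp M X Ms Xs Q Z W' \<longrightarrow>
          distr P borel X' = distr Q borel W'))
     \<and>
     (\<forall>(Mz :: 'c measure) Xz.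
       integrable M (\<lambda>\<omega>. (X \<omega>)\<^sup>2) \<longrightarrow> zero_biased M X Mz Xz \<longrightarrow>
         (infinitely_divisible (distr M borel X) \<longleftrightarrow>
           (\<exists>(P :: (real \<times> real) measure) Y X'' (Q :: real measure) X'.
              indep_decomp M X Mz Xz P Y X'' \<and> tail_density P X'' Q X'))
         \<and>
         (infinitely_divisible (distr M borel X) \<longrightarrow>
           (\<forall>(P :: 'p measure) Y X'' (Q :: 'q measure) Z X'.
              indep_decomp M X Mz Xz P Y X'' \<longrightarrow> indep_decomp M X Ms Xs Q Z X' \<longrightarrow>
              tail_density P X'' Q X')))"
proof -
  interpret M: prob_space M by fact
  note X = \<open>X \<in> borel_measurable M\<close>
  define \<mu> where "\<mu> = distr M borel X"
  define \<sigma> where "\<sigma> = distr Ms borel Xs"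
  define m where "m = (\<integral>\<omega>. X \<omega> \<partial>M)"
  \<comment> \<open>A nonnegative variable with mean 0 vanishes almost surely, against the positive
    variance.\<close>
  have "m \<noteq> 0"
  proof
    assume "m = 0"
    then have "AE \<omega> in M. X \<omega> = 0"
      using integral_nonneg_eq_0_iff_AE[OF finite_mean nonneg] by (simp add: m_def)
    then have "(\<integral>\<^sup>+\<omega>. ennreal ((X \<omega> - m)\<^sup>2) \<partial>M) = (\<integral>\<^sup>+\<omega>. 0 \<partial>M)"
      by (intro nn_integral_cong_AE) (auto simp: \<open>m = 0\<close>)
    with var_pos show False
      by (simp add: m_def)
  qed
  moreover have "0 \<le> m"
    unfolding m_def using nonneg by (rule integral_nonneg_AE)
  ultimately have m: "0 < m" by simp
  have pm: "pos_mean_distribution (distr M borel X)"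
    using M.pos_mean_distribution_distr[OF X nonneg finite_mean] m by (simp add: m_def)
  then interpret \<mu>: pos_mean_distribution \<mu>
    by (simp add: \<mu>_def)
  have rd_\<mu>: "real_distribution \<mu>" ..
  have mean: "(\<integral>x. x \<partial>\<mu>) = m"
    by (simp add: \<mu>_def m_def integral_distr[OF X])
  have \<sigma>: "\<sigma> = size_law \<mu>"
    unfolding \<sigma>_def \<mu>_def by (rule size_biased_distr[OF X finite_mean pm Xs])
  interpret \<sigma>: nonneg_distribution \<sigma>
    unfolding \<sigma> by (rule \<mu>.nonneg_distribution_size_law)
  have rd_\<sigma>: "real_distribution \<sigma>" ..

  \<comment> \<open>Size bias: existence and uniqueness of the independent summand\<close>
  have part_a: "infinitely_divisible \<mu> \<longleftrightarrow>
      (\<exists>(P :: (real \<times> real) measure) Y X'.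
        indep_decomp M X Ms Xs P Y X' \<and> (AE \<omega> in P. 0 \<le> X' \<omega>))"
  proof
    assume "infinitely_divisible \<mu>"
    then obtain \<nu> where \<nu>: "nonneg_distribution \<nu>" and eq: "\<And>t. char \<sigma> t = char \<mu> t * char \<nu> t"
      using \<mu>.infinitely_divisible_iff_char_size_law \<sigma> by auto
    interpret \<nu>: nonneg_distribution \<nu> by fact
    have "real_distribution \<nu>" ..
    note dec = indep_decomp_pair[OF rd_\<mu>[unfolded \<mu>_def] rd_\<sigma>[unfolded \<sigma>_def] this eq[unfolded \<mu>_def \<sigma>_def]]
    have "AE x in distr (distr M borel X \<Otimes>\<^sub>M \<nu>) borel snd. 0 \<le> x"
      unfolding dec(2) by (rule \<nu>.nonneg)
    then have "AE \<omega> in distr M borel X \<Otimes>\<^sub>M \<nu>. 0 \<le> snd \<omega>"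
      by (subst (asm) AE_distr_iff) auto
    with dec(1) show "\<exists>(P :: (real \<times> real) measure) Y X'.
        indep_decomp M X Ms Xs P Y X' \<and> (AE \<omega> in P. 0 \<le> X' \<omega>)"
      by blast
  next
    assume "\<exists>(P :: (real \<times> real) measure) Y X'.
      indep_decomp M X Ms Xs P Y X' \<and> (AE \<omega> in P. 0 \<le> X' \<omega>)"
    then obtain P :: "(real \<times> real) measure" and Y X' where
      dec: "indep_decomp M X Ms Xs P Y X'" and nn: "AE \<omega> in P. 0 \<le> X' \<omega>"
      by blast
    have "nonneg_distribution (distr P borel X')"
      using prob_space.nonneg_distribution_distr[OF indep_decompD(1,2)[OF dec] nn] .
    moreover have "char (size_law \<mu>) t = char \<mu> t * char (distr P borel X') t" for t
      using indep_decompD(3)[OF dec, of t] unfolding \<sigma>[symmetric] by (simp add: \<sigma>_def \<mu>_def)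
    ultimately show "infinitely_divisible \<mu>"
      using \<mu>.infinitely_divisible_iff_char_size_law by blast
  qed

  have part_a_unique: "distr P borel X' = distr Q borel W'"
    if "infinitely_divisible \<mu>" and P: "indep_decomp M X Ms Xs P Y X'" and Q: "indep_decomp M X Ms Xs Q Z W'"
    for P :: "'p measure" and Y X' and Q :: "'q measure" and Z W'
  proof (rule \<mu>.distr_eq_if_char_mult_eq[OF that(1) indep_decompD(1,2)[OF P]])
    show "real_distribution (distr Q borel W')"
      using prob_space.real_distribution_distr[OF indep_decompD(1,2)[OF Q]] .
    show "char \<mu> t * char (distr P borel X') t = char \<mu> t * char (distr Q borel W') t" for t
      using indep_decompD(3)[OF P, of t] indep_decompD(3)[OF Q, of t] by (auto simp: \<mu>_def)
  qed

  \<comment> \<open>Zero bias: existence and density of the independent summand\<close>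
  have part_b: "(infinitely_divisible \<mu> \<longleftrightarrow>
          (\<exists>(P :: (real \<times> real) measure) Y X'' (Q :: real measure) X'.
            indep_decomp M X Mz Xz P Y X'' \<and> tail_density P X'' Q X'))
      \<and> (infinitely_divisible \<mu> \<longrightarrow>
          (\<forall>(P :: 'p measure) Y X'' (Q :: 'q measure) Z X'.
            indep_decomp M X Mz Xz P Y X'' \<longrightarrow> indep_decomp M X Ms Xs Q Z X' \<longrightarrow>
            tail_density P X'' Q X'))"
    if sq: "integrable M (\<lambda>\<omega>. (X \<omega>)\<^sup>2)" and zb: "zero_biased M X Mz Xz"
    for Mz :: "'c measure" and Xz
  proof -
    define \<zeta> where "\<zeta> = distr Mz borel Xz"
    interpret \<zeta>: real_distribution \<zeta>
      using zb unfolding \<zeta>_def zero_biased_def by (simp add: prob_space.real_distribution_distr)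
    have rd_\<zeta>: "real_distribution \<zeta>" ..
    define v where "v = M.variance X"
    have v_eq: "v = (\<integral>\<omega>. (X \<omega>)\<^sup>2 \<partial>M) - m\<^sup>2"
      unfolding v_def m_def by (rule M.variance_eq[OF finite_mean sq])
    have "integrable M (\<lambda>\<omega>. (X \<omega> - m)\<^sup>2)"
      using finite_mean sq by (simp add: power2_diff)
    then have "(\<integral>\<^sup>+\<omega>. ennreal ((X \<omega> - m)\<^sup>2) \<partial>M) = ennreal v"
      unfolding v_def m_def by (intro nn_integral_eq_integral) auto
    \<comment> \<open>With a finite second moment the extended integral in \<open>var_pos\<close> is
      the real variance \<open>v\<close>.\<close>
    then have "0 < ennreal v"
      using var_pos unfolding m_def by simp
    then have v: "0 < v"
      by simp
    have zeta: "of_real v * (\<i> * of_real t) * char \<zeta> t = of_real m * (char \<sigma> t - char \<mu> t)" for t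
      using zero_biased_char[OF \<open>prob_space M\<close> X finite_mean pm zb, of t]
      by (simp add: v_def m_def \<zeta>_def \<sigma> \<mu>_def)
    have sq_\<mu>: "integrable \<mu> (\<lambda>x. x * x)" "(\<integral>x. x * x \<partial>\<mu>) = (\<integral>\<omega>. (X \<omega>)\<^sup>2 \<partial>M)"
      using sq by (simp_all add: \<mu>_def integrable_distr_eq[OF X] integral_distr[OF X] power2_eq_square)
    have int_\<sigma>: "integrable \<sigma> (\<lambda>x. x)"
      unfolding \<sigma> size_law_def using \<mu>.AE_size_density_nonneg sq_\<mu>(1)
      by (subst integrable_density) (simp_all add: mean)
    \<comment> \<open>\<open>m\<close> times the size biased mean is the second moment of
      \<open>X\<close>.\<close>
    have mean_\<sigma>: "m * (\<integral>x. x \<partial>\<sigma>) = v + m\<^sup>2"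
      using m by (simp add: \<sigma> \<mu>.integral_size_law sq_\<mu>(2) mean v_eq)
    \<comment> \<open>Subtracting means in \<open>\<sigma> = \<mu> * \<nu>\<close> (convolution)
      leaves \<open>v / m\<close> for \<open>\<nu>\<close>, which is positive.\<close>
    have mean_\<nu>: "pos_mean_distribution \<nu>" "v = m * (\<integral>x. x \<partial>\<nu>)"
      if "nonneg_distribution \<nu>" "\<And>t. char \<sigma> t = char \<mu> t * char \<nu> t" for \<nu>
    proof -
      interpret \<nu>: nonneg_distribution \<nu> by fact
      have "real_distribution \<nu>" ..
      note factor = char_factor_mean[OF rd_\<mu> rd_\<sigma> this \<mu>.integrable_id int_\<sigma> that(2)]
      show v_eq: "v = m * (\<integral>x. x \<partial>\<nu>)"
        using mean_\<sigma> factor(2) by (simp add: mean power2_eq_square distrib_left)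
      with v m have "0 < (\<integral>x. x \<partial>\<nu>)"
        by (simp add: zero_less_mult_iff)
      with factor(1) show "pos_mean_distribution \<nu>"
        by unfold_locales
    qed
    \<comment> \<open>In \<open>zeta\<close> the difference becomes
      \<open>char \<mu> t * (char \<nu> t - 1)\<close>; since \<open>v\<close> is \<open>m\<close>
      times the mean of \<open>\<nu>\<close>, \<open>char_tail_law\<close> makes the prefactors
      agree. They cancel for nonzero \<open>t\<close>, and at \<open>t = 0\<close> all values are
      1.\<close>
    have char_\<zeta>: "char \<zeta> t = char \<mu> t * char (tail_law \<nu>) t"
      if "nonneg_distribution \<nu>" "\<And>t. char \<sigma> t = char \<mu> t * char \<nu> t" for \<nu> t
    proof -
      interpret \<nu>: pos_mean_distribution \<nu>
        using that by (rule mean_\<nu>)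
      interpret \<tau>: real_distribution "tail_law \<nu>"
        by (rule \<nu>.real_distribution_tail_law)
      show ?thesis
      proof (cases "t = 0")
        case True
        then show ?thesis
          by (simp add: \<zeta>.char_zero \<mu>.char_zero \<tau>.char_zero)
      next
        case False
        have "of_real v * (\<i> * of_real t) * char \<zeta> t = of_real m * char \<mu> t * (char \<nu> t - 1)"
          unfolding zeta that(2) by (simp add: algebra_simps)
        also have "\<dots> = of_real v * (\<i> * of_real t) * (char \<mu> t * char (tail_law \<nu>) t)"
          unfolding \<nu>.char_tail_law[symmetric] mean_\<nu>(2)[OF that] by simp
        finally show ?thesis
          using v False by simp
      qed
    qed

    have "infinitely_divisible \<mu> \<longleftrightarrow>
        (\<exists>(P :: (real \<times> real) measure) Y X'' (Q :: real measure) X'.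
          indep_decomp M X Mz Xz P Y X'' \<and> tail_density P X'' Q X')"
    proof
      assume "infinitely_divisible \<mu>"
      then obtain \<nu> where \<nu>: "nonneg_distribution \<nu>" and eq: "\<And>t. char \<sigma> t = char \<mu> t * char \<nu> t"
        using \<mu>.infinitely_divisible_iff_char_size_law \<sigma> by auto
      interpret \<nu>: pos_mean_distribution \<nu>
        using \<nu> eq by (rule mean_\<nu>)
      note dec = indep_decomp_pair[OF rd_\<mu>[unfolded \<mu>_def] rd_\<zeta>[unfolded \<zeta>_def]
          \<nu>.real_distribution_tail_law char_\<zeta>[OF \<nu> eq, unfolded \<mu>_def \<zeta>_def]]
      have id: "distr \<nu> borel (\<lambda>x. x) = \<nu>"
        by (simp add: distr_id2)
      \<comment> \<open>The witness for \<open>X'\<close> is the identity on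
        \<open>\<nu>\<close>.\<close>
      have "tail_density (distr M borel X \<Otimes>\<^sub>M tail_law \<nu>) snd \<nu> (\<lambda>x. x)"
        using indep_decompD(1,2)[OF dec(1)] \<nu>.pos_mean_distribution_axioms \<nu>.prob_space_axioms dec(2)
        by (subst tail_density_iff) (simp_all add: id)
      with dec(1) show "\<exists>(P :: (real \<times> real) measure) Y X'' (Q :: real measure) X'.
          indep_decomp M X Mz Xz P Y X'' \<and> tail_density P X'' Q X'"
        by blast
    next
      assume "\<exists>(P :: (real \<times> real) measure) Y X'' (Q :: real measure) X'.
          indep_decomp M X Mz Xz P Y X'' \<and> tail_density P X'' Q X'"
      then obtain P :: "(real \<times> real) measure" and Y X'' and Q :: "real measure" and X' where
        dec: "indep_decomp M X Mz Xz P Y X''" and td: "tail_density P X'' Q X'"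
        by blast
      define \<nu> where "\<nu> = distr Q borel X'"
      interpret \<nu>: pos_mean_distribution \<nu>
        unfolding \<nu>_def using td by (rule tail_densityD)
      have \<nu>: "nonneg_distribution \<nu>" ..
      define a where "a = (\<integral>x. x \<partial>\<nu>)"
      have a: "0 < a"
        unfolding a_def by (rule \<nu>.mean_pos)
      have \<zeta>_eq: "char \<zeta> t = char \<mu> t * char (tail_law \<nu>) t" for t
        using indep_decompD(3)[OF dec, of t] tail_densityD(2)[OF td] by (simp add: \<zeta>_def \<mu>_def \<nu>_def)
      \<comment> \<open>Here \<open>X'\<close> is linked to \<open>X\<close> only through the tail
        density, so the constant \<open>v / (m * a)\<close> need not be 1. Multiplying
        \<open>zeta\<close> by \<open>a\<close> allows \<open>char_tail_law\<close> to be
        inserted.\<close>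
      have eq: "char (size_law \<mu>) t = char \<mu> t * (1 + of_real (v / (m * a)) * (char \<nu> t - 1))" for t
      proof -
        have "of_real a * (of_real m * (char \<sigma> t - char \<mu> t)) = of_real v * char \<mu> t * (char \<nu> t - 1)"
          unfolding zeta[symmetric] \<zeta>_eq \<nu>.char_tail_law[symmetric] a_def by simp
        then show ?thesis
          using m a by (simp add: \<sigma> field_simps)
      qed
      show "infinitely_divisible \<mu>"
        using \<mu>.infinitely_divisible_if_char_size_law[OF \<nu> _ eq] v m a by simp
    qed
    moreover have "tail_density P X'' Q X'"
      if "infinitely_divisible \<mu>" and P: "indep_decomp M X Mz Xz P Y X''"
        and Q: "indep_decomp M X Ms Xs Q Z X'"
      for P :: "'p measure" and Y X'' and Q :: "'q measure" and Z X'
    proof -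
      obtain \<nu> where \<nu>: "nonneg_distribution \<nu>" and eq: "\<And>t. char \<sigma> t = char \<mu> t * char \<nu> t"
        using \<open>infinitely_divisible \<mu>\<close> \<mu>.infinitely_divisible_iff_char_size_law \<sigma> by auto
      interpret \<nu>: pos_mean_distribution \<nu>
        using \<nu> eq by (rule mean_\<nu>)
      \<comment> \<open>Uniqueness identifies the given \<open>X'\<close> with the factor
        \<open>\<nu>\<close>, and below the given \<open>X''\<close> with its tail law.\<close>
      have "distr Q borel X' = \<nu>"
      proof (rule \<mu>.distr_eq_if_char_mult_eq[OF that(1) indep_decompD(1,2)[OF Q]])
        show "char \<mu> t * char (distr Q borel X') t = char \<mu> t * char \<nu> t" for t
          using indep_decompD(3)[OF Q, of t] eq[of t] by (simp add: \<mu>_def \<sigma>_def)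
      qed unfold_locales
      moreover have "distr P borel X'' = tail_law \<nu>"
      proof (rule \<mu>.distr_eq_if_char_mult_eq[OF that(1) indep_decompD(1,2)[OF P] \<nu>.real_distribution_tail_law])
        show "char \<mu> t * char (distr P borel X'') t = char \<mu> t * char (tail_law \<nu>) t" for t
          using indep_decompD(3)[OF P, of t] char_\<zeta>[OF \<nu> eq, of t] by (simp add: \<mu>_def \<zeta>_def)
      qed
      ultimately show ?thesis
        using indep_decompD(1,2)[OF P] indep_decompD(1,2)[OF Q] \<nu>.pos_mean_distribution_axioms
        by (subst tail_density_iff) simp_all
    qed
    ultimately show ?thesis
      by blast
  qed
  show ?thesis
    unfolding \<mu>_def[symmetric] using part_a part_a_unique part_b by blast
qed

end
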